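(* Let $p_1,p_2\ge 3$ be integers with $\frac{\pi}{2}+\frac{\pi}{p_1}+\frac{\pi}{p_2}<\pi$. Let $ABC$ be a triangle in the hyperbolic plane $\mathbf{H}^2$ with angles $\frac{\pi}{2},\frac{\pi}{p_1},\frac{\pi}{p_2}$ at $A,B,C$ respectively, and let $\Gamma_0$ be the discrete group generated by the rotation $\mathbf{g}_0$ by $\pi$ about $A$ and the rotation $\mathbf{g}_1$ by $\frac{2\pi}{p_1}$ about $B$, where $\mathbf{g}_2=\mathbf{g}_0\mathbf{g}_1$ is a rotation by $\frac{2\pi}{p_2}$ about $C$. Then there exists exactly one point $K$ in the interior of the triangle $ABC$ such that the Dirichlet--Voronoi cell $\mathcal{D}(K)_{\Gamma_0}$ of $\Gamma_0$ with kernel point $K$ is circumscribed about a circle centred at $K$, i.e. there is a circle centred at $K$ that is tangent to all sides of $\mathcal{D}(K)_{\Gamma_0}$.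
   Context: $\mathbf{H}^2$ is the hyperbolic plane of constant curvature $-1$ with distance $d$. The sense of the rotations is chosen so that the product $\mathbf{g}_0\mathbf{g}_1$ is a rotation by $2\pi/p_2$ about $C$; $\Gamma_0$ has the presentation $\langle \mathbf{g}_0,\mathbf{g}_1\mid \mathbf{g}_0^2,\ \mathbf{g}_1^{p_1},\ (\mathbf{g}_0\mathbf{g}_1)^{p_2}\rangle$ (it is the orientation-preserving subgroup of the group generated by the reflections in the sides of $ABC$). For a point $K$, write $K^{\mathbf{g}}$ for its image under $\mathbf{g}\in\Gamma_0$. The Dirichlet--Voronoi cell of $\Gamma_0$ with kernel point $K$ is $\mathcal{D}(K)_{\Gamma_0}=\{X\in\mathbf{H}^2 : d(K,X)\le d(K^{\mathbf{g}},X)\ \text{for all } \mathbf{g}\in\Gamma_0\}$. For $K$ in the interior of $ABC$ it is a fundamental domain of $\Gamma_0$, a pentagon whose sides lie on the perpendicular bisectors of the segments joining $K$ to $K^{\mathbf{g}_0}$, $K^{\mathbf{g}_1}$, $K^{\mathbf{g}_1^{-1}}$, $K^{\mathbf{g}_2}$, $K^{\mathbf{g}_2^{-1}}$. *)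

theory Defs
  imports "HOL-Analysis.Analysis" "HOL-Algebra.Generated_Groups" "HOL-Algebra.Bij"
begin

text \<open>The hyperbolic plane of curvature -1 is the upper sheet of the hyperboloid in Minkowski
  space \<open>real ^ 3\<close>, with form of signature (+,+,-).\<close>

definition lorentz :: "real ^ 3 \<Rightarrow> real ^ 3 \<Rightarrow> real" where
  "lorentz X Y = X $ 1 * Y $ 1 + X $ 2 * Y $ 2 - X $ 3 * Y $ 3"

definition H2 :: "(real ^ 3) set" where
  "H2 = {X. lorentz X X = -1 \<and> X $ 3 > 0}"

definition hdist :: "real ^ 3 \<Rightarrow> real ^ 3 \<Rightarrow> real" where
  "hdist X Y = arcosh (- lorentz X Y)"

definition hline :: "(real ^ 3) set \<Rightarrow> bool" where
  "hline L \<longleftrightarrow> (\<exists>n. lorentz n n > 0 \<and> L = {X \<in> H2. lorentz n X = 0})"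

definition hcircle :: "real ^ 3 \<Rightarrow> real \<Rightarrow> (real ^ 3) set" where
  "hcircle K r = {X \<in> H2. hdist K X = r}"

text \<open>\<open>htangent P X\<close> is the component of \<open>X\<close> in the tangent plane of the hyperboloid at \<open>P\<close>.
  For \<open>X \<in> H2\<close>, \<open>X \<noteq> P\<close> it is a positive multiple of the initial velocity of the geodesic
  from \<open>P\<close> to \<open>X\<close>.\<close>

definition htangent :: "real ^ 3 \<Rightarrow> real ^ 3 \<Rightarrow> real ^ 3" where
  "htangent P X = X + lorentz P X *\<^sub>R P"

text \<open>The angle XPY at the vertex \<open>P\<close>; meaningful for \<open>X \<noteq> P\<close> and \<open>Y \<noteq> P\<close>.\<close>

definition hangle :: "real ^ 3 \<Rightarrow> real ^ 3 \<Rightarrow> real ^ 3 \<Rightarrow> real" where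
  "hangle X P Y =
     arccos (lorentz (htangent P X) (htangent P Y) /
       (sqrt (lorentz (htangent P X) (htangent P X)) *
        sqrt (lorentz (htangent P Y) (htangent P Y))))"

definition htriangle :: "real ^ 3 \<Rightarrow> real ^ 3 \<Rightarrow> real ^ 3 \<Rightarrow> bool" where
  "htriangle A B C \<longleftrightarrow>
     A \<in> H2 \<and> B \<in> H2 \<and> C \<in> H2 \<and> \<not> (\<exists>L. hline L \<and> {A, B, C} \<subseteq> L)"

text \<open>The hyperbolic triangle is the radial projection to the hyperboloid of the Euclidean
  triangle with the same vertices, hence its interior consists of the positive combinations
  of the vertices that lie on the hyperboloid.\<close>

definition htriangle_interior :: "real ^ 3 \<Rightarrow> real ^ 3 \<Rightarrow> real ^ 3 \<Rightarrow> (real ^ 3) set" where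
  "htriangle_interior A B C =
     {X \<in> H2. \<exists>a b c. a > 0 \<and> b > 0 \<and> c > 0 \<and> X = a *\<^sub>R A + b *\<^sub>R B + c *\<^sub>R C}"

text \<open>Geodesic polar coordinates about \<open>P\<close>, with respect to an orthonormal frame \<open>e\<close>, \<open>f\<close> of
  the tangent plane at \<open>P\<close>.\<close>

definition tangent_frame :: "real ^ 3 \<Rightarrow> real ^ 3 \<Rightarrow> real ^ 3 \<Rightarrow> bool" where
  "tangent_frame P e f \<longleftrightarrow>
     lorentz P e = 0 \<and> lorentz P f = 0 \<and> lorentz e f = 0 \<and> lorentz e e = 1 \<and> lorentz f f = 1"

definition hpolar :: "real ^ 3 \<Rightarrow> real ^ 3 \<Rightarrow> real ^ 3 \<Rightarrow> real \<Rightarrow> real \<Rightarrow> real ^ 3" where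
  "hpolar P e f \<rho> \<phi> = cosh \<rho> *\<^sub>R P + sinh \<rho> *\<^sub>R (cos \<phi> *\<^sub>R e + sin \<phi> *\<^sub>R f)"

text \<open>Rotation about \<open>P\<close> by \<open>\<theta>\<close>, in either sense, since the orientation of the frame is not
  prescribed. Transformations of the plane are elements of \<open>BijGroup H2\<close>, whose elements are
  extensional on \<open>H2\<close>.\<close>

definition is_hrotation :: "real ^ 3 \<Rightarrow> real \<Rightarrow> (real ^ 3 \<Rightarrow> real ^ 3) \<Rightarrow> bool" where
  "is_hrotation P \<theta> g \<longleftrightarrow>
     P \<in> H2 \<and> g \<in> carrier (BijGroup H2) \<and>
     (\<exists>e f. tangent_frame P e f \<and>
       (\<forall>\<rho>\<ge>0. \<forall>\<phi>. g (hpolar P e f \<rho> \<phi>) = hpolar P e f \<rho> (\<phi> + \<theta>)))"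

definition dirichlet_cell :: "(real ^ 3 \<Rightarrow> real ^ 3) set \<Rightarrow> real ^ 3 \<Rightarrow> (real ^ 3) set" where
  "dirichlet_cell \<Gamma> K = {X \<in> H2. \<forall>g\<in>\<Gamma>. hdist K X \<le> hdist (g K) X}"

text \<open>A side of a convex region: a nondegenerate intersection with a geodesic that has the
  region on one side of it.\<close>

definition is_side :: "(real ^ 3) set \<Rightarrow> (real ^ 3) set \<Rightarrow> bool" where
  "is_side D S \<longleftrightarrow>
     (\<exists>n. lorentz n n > 0 \<and> (\<forall>X\<in>D. lorentz n X \<le> 0) \<and> S = {X \<in> D. lorentz n X = 0}) \<and>
     (\<exists>X\<in>S. \<exists>Y\<in>S. X \<noteq> Y)"

text \<open>The point of contact is required to lie on the side itself, not only on the geodesic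
  that carries it.\<close>

definition circle_tangent_to_side :: "real ^ 3 \<Rightarrow> real \<Rightarrow> (real ^ 3) set \<Rightarrow> bool" where
  "circle_tangent_to_side K r S \<longleftrightarrow>
     (\<exists>L. hline L \<and> S \<subseteq> L \<and> (\<exists>X\<in>S. hcircle K r \<inter> L = {X}))"

definition circumscribed_about_circle_at :: "(real ^ 3) set \<Rightarrow> real ^ 3 \<Rightarrow> bool" where
  "circumscribed_about_circle_at D K \<longleftrightarrow>
     (\<exists>r>0. \<forall>S. is_side D S \<longrightarrow> circle_tangent_to_side K r S)"

lemma lorentz_simps:
  "lorentz (X + Y) Z = lorentz X Z + lorentz Y Z"
  "lorentz X (Y + Z) = lorentz X Y + lorentz X Z"
  "lorentz (a *\<^sub>R X) Y = a * lorentz X Y"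
  "lorentz X (a *\<^sub>R Y) = a * lorentz X Y"
  by (simp_all add: lorentz_def algebra_simps)

lemma lorentz_commute: "lorentz X Y = lorentz Y X"
  by (simp add: lorentz_def algebra_simps)

lemma lorentz_hpolar:
  assumes "P \<in> H2" "tangent_frame P e f"
  shows "lorentz (hpolar P e f \<rho> \<phi>) (hpolar P e f \<sigma> \<psi>) =
    sinh \<rho> * sinh \<sigma> * cos (\<phi> - \<psi>) - cosh \<rho> * cosh \<sigma>"
proof -
  have "lorentz P P = -1" "lorentz P e = 0" "lorentz P f = 0" "lorentz e P = 0" "lorentz f P = 0"
    "lorentz e f = 0" "lorentz f e = 0" "lorentz e e = 1" "lorentz f f = 1"
    using assms by (auto simp: H2_def tangent_frame_def lorentz_commute)
  then show ?thesis
    by (simp add: hpolar_def lorentz_simps cos_diff algebra_simps)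
qed

text \<open>The radial coordinate is the distance from the centre, and the angle at the centre
  between two points is the difference of their angular coordinates.\<close>

lemma hdist_hpolar:
  assumes "P \<in> H2" "tangent_frame P e f" "\<rho> \<ge> 0"
  shows "hdist P (hpolar P e f \<rho> \<phi>) = \<rho>"
  using lorentz_hpolar[OF assms(1,2), of 0 0 \<rho> \<phi>] assms(3)
  by (simp add: hdist_def hpolar_def[of P e f 0] arcosh_cosh_real)

lemma hangle_hpolar:
  assumes "P \<in> H2" "tangent_frame P e f" "\<rho> > 0" "\<sigma> > 0"
  shows "hangle (hpolar P e f \<rho> \<phi>) P (hpolar P e f \<sigma> \<psi>) = arccos (cos (\<phi> - \<psi>))"
proof -
  have PP: "lorentz P P = -1" "lorentz P e = 0" "lorentz P f = 0" "lorentz e f = 0"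
    "lorentz f e = 0" "lorentz e e = 1" "lorentz f f = 1"
    using assms by (auto simp: H2_def tangent_frame_def lorentz_commute)
  have t: "htangent P (hpolar P e f r a) = sinh r *\<^sub>R (cos a *\<^sub>R e + sin a *\<^sub>R f)" for r a
    by (simp add: htangent_def hpolar_def lorentz_simps PP)
  have l: "lorentz (htangent P (hpolar P e f r a)) (htangent P (hpolar P e f s b)) =
      sinh r * sinh s * cos (a - b)" for r s a b
    unfolding t by (simp add: lorentz_simps PP cos_diff algebra_simps)
  show ?thesis
    unfolding hangle_def l using assms(3,4) by simp
qed

end

theory Submission
  imports Defs
begin

text \<open>Let \<open>s\<^sub>1, s\<^sub>2, s\<^sub>3\<close> be the reflections in the sides of the triangle, opposite \<open>A\<close>, \<open>B\<close>, \<open>C\<close>.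
  The group consists of the even words in them. Tits' positivity of roots shows that for \<open>K\<close> and
  \<open>Y\<close> in the triangle the nearest even image of \<open>K\<close> to \<open>Y\<close> is \<open>K\<close> itself, and the nearest odd
  image is some \<open>s\<^sub>i K\<close>. Hence the cell is cut out by the bisectors of \<open>K\<close> and \<open>s\<^sub>i s\<^sub>j K\<close>, each of
  which carries a side, and it is circumscribed about a circle exactly when the displacements
  \<open>d(K, s\<^sub>i s\<^sub>j K)\<close> agree. In the coordinates \<open>(x, y, z)\<close> of \<open>K\<close> with respect to the unit normals,
  with \<open>c\<^sub>i = cos (\<pi> / p\<^sub>i)\<close>, this reads \<open>y\<^sup>2 = x\<^sup>2 + 2 c\<^sub>1 x z\<close>, \<open>z\<^sup>2 = x\<^sup>2 + 2 c\<^sub>2 x y\<close>, which has exactly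
  one positive solution up to scaling.\<close>

section \<open>The Lorentz form\<close>

text \<open>The cell is given by infinitely many inequalities, and the difficulty is to discard all
  but those of the neighbours. As \<open>cosh d\<close> is minus the Lorentz product, each
  inequality is linear in \<open>X\<close>. Lengthening a reduced word moves the image of
  \<open>K\<close> along a root, so signs of roots decide which image is nearer. This length
  argument lives in the full reflection group; parity is tracked to return to the rotations. The
  equations come from \<open>sinh\<^sup>2 (d / 2) = u\<^sup>2 + v\<^sup>2 + 2 u v cos
  \<theta>\<close>, where \<open>d\<close> is the displacement of \<open>K\<close> under two
  reflections, \<open>u\<close>, \<open>v\<close> are its coordinates at their walls and
  \<open>\<theta>\<close> is the angle of the walls. At the right angle the mixed term vanishes, and
  the two orders of the reflections agree, so six ordered pairs give five images.\<close>

lemma lorentz_linear: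
  "lorentz (X + Y) Z = lorentz X Z + lorentz Y Z"
  "lorentz X (Y + Z) = lorentz X Y + lorentz X Z"
  "lorentz (X - Y) Z = lorentz X Z - lorentz Y Z"
  "lorentz X (Y - Z) = lorentz X Y - lorentz X Z"
  "lorentz (a *\<^sub>R X) Y = a * lorentz X Y"
  "lorentz X (a *\<^sub>R Y) = a * lorentz X Y"
  "lorentz (- X) Y = - lorentz X Y"
  "lorentz X (- Y) = - lorentz X Y"
  "lorentz 0 Y = 0"
  "lorentz X 0 = 0"
  by (simp_all add: lorentz_def algebra_simps)

text \<open>The Euclidean cross product with its third entry negated, so that
  \<open>lorentz (lcross X Y) Z\<close> is the determinant of \<open>X\<close>, \<open>Y\<close>,
  \<open>Z\<close>.\<close>

definition lcross :: "real ^ 3 \<Rightarrow> real ^ 3 \<Rightarrow> real ^ 3" where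
  "lcross X Y = vector [X$2 * Y$3 - X$3 * Y$2, X$3 * Y$1 - X$1 * Y$3, X$2 * Y$1 - X$1 * Y$2]"

lemma lorentz_lcross_self [simp]: "lorentz (lcross X Y) X = 0" "lorentz (lcross X Y) Y = 0"
  by (simp_all add: lorentz_def lcross_def algebra_simps)

lemma lorentz_lcross_rotate: "lorentz (lcross X Y) Z = lorentz (lcross Y Z) X"
  by (simp add: lorentz_def lcross_def algebra_simps)

lemma lorentz_lcross_lcross:
  "lorentz (lcross X Y) (lcross Z W) = lorentz X W * lorentz Y Z - lorentz X Z * lorentz Y W"
  by (simp add: lorentz_def lcross_def algebra_simps)

text \<open>Cramer's rule, kept free of division; the lemma after it is the version for the dual
  basis.\<close>

lemma lcross_expand:
  "lorentz (lcross X Y) Z *\<^sub>R W =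
    lorentz (lcross Y Z) W *\<^sub>R X + lorentz (lcross Z X) W *\<^sub>R Y + lorentz (lcross X Y) W *\<^sub>R Z"
  by (simp add: vec_eq_iff forall_3 lorentz_def lcross_def algebra_simps)

lemma lcross_expand_dual:
  "lorentz (lcross X Y) Z *\<^sub>R W =
    lorentz X W *\<^sub>R lcross Y Z + lorentz Y W *\<^sub>R lcross Z X + lorentz Z W *\<^sub>R lcross X Y"
  by (simp add: vec_eq_iff forall_3 lorentz_def lcross_def algebra_simps)

section \<open>Timelike and spacelike vectors\<close>

lemma lorentz_le_minus_one:
  assumes "X \<in> H2" "Y \<in> H2"
  shows "lorentz X Y \<le> -1"
proof -
  have X: "(X$3)\<^sup>2 = 1 + (X$1)\<^sup>2 + (X$2)\<^sup>2" "X$3 > 0" and Y: "(Y$3)\<^sup>2 = 1 + (Y$1)\<^sup>2 + (Y$2)\<^sup>2" "Y$3 > 0"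
    using assms by (auto simp: H2_def lorentz_def power2_eq_square)
  \<comment> \<open>Lagrange's identity for \<open>(1, X$1, X$2)\<close> and
    \<open>(1, Y$1, Y$2)\<close>. It gives the reversed Cauchy-Schwarz inequality and, in the next
    lemma, its equality case.\<close>
  have "(X$3 * Y$3)\<^sup>2 - (1 + X$1 * Y$1 + X$2 * Y$2)\<^sup>2
      = (X$1 - Y$1)\<^sup>2 + (X$2 - Y$2)\<^sup>2 + (X$1 * Y$2 - X$2 * Y$1)\<^sup>2"
    unfolding power_mult_distrib X Y by algebra
  then have "(1 + X$1 * Y$1 + X$2 * Y$2)\<^sup>2 \<le> (X$3 * Y$3)\<^sup>2"
    by (smt (verit) zero_le_power2)
  then have "1 + X$1 * Y$1 + X$2 * Y$2 \<le> X$3 * Y$3"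
    by (rule power2_le_imp_le) (use X Y in auto)
  then show ?thesis by (simp add: lorentz_def)
qed

lemma lorentz_eq_minus_one:
  assumes "X \<in> H2" "Y \<in> H2" "lorentz X Y = -1"
  shows "X = Y"
proof -
  have X: "(X$3)\<^sup>2 = 1 + (X$1)\<^sup>2 + (X$2)\<^sup>2" "X$3 > 0" and Y: "(Y$3)\<^sup>2 = 1 + (Y$1)\<^sup>2 + (Y$2)\<^sup>2" "Y$3 > 0"
    using assms by (auto simp: H2_def lorentz_def power2_eq_square)
  have e: "X$3 * Y$3 = 1 + X$1 * Y$1 + X$2 * Y$2" using assms(3) by (simp add: lorentz_def)
  have "(X$3 * Y$3)\<^sup>2 - (1 + X$1 * Y$1 + X$2 * Y$2)\<^sup>2
      = (X$1 - Y$1)\<^sup>2 + (X$2 - Y$2)\<^sup>2 + (X$1 * Y$2 - X$2 * Y$1)\<^sup>2"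
    unfolding power_mult_distrib X Y by algebra
  then have "(X$1 - Y$1)\<^sup>2 + (X$2 - Y$2)\<^sup>2 + (X$1 * Y$2 - X$2 * Y$1)\<^sup>2 = 0"
    using e by simp
  then have 12: "X$1 = Y$1" "X$2 = Y$2"
    by (smt (verit) zero_le_power2 zero_eq_power2)+
  then have "(X$3)\<^sup>2 = (Y$3)\<^sup>2" using X Y by simp
  then have "X$3 = Y$3" using X(2) Y(2) by (simp add: power2_eq_iff)
  with 12 show ?thesis by (simp add: vec_eq_iff forall_3)
qed

text \<open>On the lower sheet \<open>- X\<close> would be in \<open>H2\<close>, making the product
  with \<open>Y\<close> at least 1. Membership thus follows from two products, without
  coordinates.\<close>

lemma H2_same_sheet:
  assumes "Y \<in> H2" "lorentz X X = -1" "lorentz X Y < 0"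
  shows "X \<in> H2"
proof (rule ccontr)
  assume "X \<notin> H2"
  then have "X$3 \<le> 0" using assms by (auto simp: H2_def)
  moreover have "X$3 \<noteq> 0" using assms(2)
    by (auto simp: lorentz_def) (smt (verit) zero_le_square)
  ultimately have "- X \<in> H2" using assms(2) by (simp add: H2_def lorentz_linear)
  from lorentz_le_minus_one[OF this assms(1)] assms(3) show False by (simp add: lorentz_linear)
qed

lemma H2_normalize:
  assumes "Y \<in> H2" "lorentz X X < 0" "lorentz X Y < 0"
  shows "(1 / sqrt (- lorentz X X)) *\<^sub>R X \<in> H2"
proof (rule H2_same_sheet[OF assms(1)])
  let ?s = "sqrt (- lorentz X X)"
  have s: "?s > 0" "?s * ?s = - lorentz X X" using assms by auto
  show "lorentz ((1 / ?s) *\<^sub>R X) ((1 / ?s) *\<^sub>R X) = -1"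
    using s by (simp add: lorentz_linear field_simps)
  show "lorentz ((1 / ?s) *\<^sub>R X) Y < 0"
    using s assms by (simp add: lorentz_linear divide_neg_pos)
qed

lemma lorentz_orthogonal_pos:
  assumes "P \<in> H2" "lorentz P n = 0" "n \<noteq> 0"
  shows "lorentz n n > 0"
proof -
  have P: "(P$3)\<^sup>2 = 1 + (P$1)\<^sup>2 + (P$2)\<^sup>2" "P$3 > 0"
    using assms by (auto simp: H2_def lorentz_def power2_eq_square)
  have e: "P$3 * n$3 = P$1 * n$1 + P$2 * n$2" using assms(2) by (simp add: lorentz_def)
  have "(P$3)\<^sup>2 * lorentz n n = (P$3)\<^sup>2 * ((n$1)\<^sup>2 + (n$2)\<^sup>2) - (P$3 * n$3)\<^sup>2"
    by (simp add: lorentz_def algebra_simps power2_eq_square)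
  also have "\<dots> = (n$1)\<^sup>2 + (n$2)\<^sup>2 + (P$1 * n$2 - P$2 * n$1)\<^sup>2"
    unfolding e P by algebra
  finally have q: "(P$3)\<^sup>2 * lorentz n n = (n$1)\<^sup>2 + (n$2)\<^sup>2 + (P$1 * n$2 - P$2 * n$1)\<^sup>2" .
  have "(n$1)\<^sup>2 + (n$2)\<^sup>2 > 0"
  proof (rule ccontr)
    assume "\<not> ?thesis"
    then have "n$1 = 0" "n$2 = 0" by (smt (verit) zero_le_power2 zero_eq_power2)+
    with e P assms(3) show False by (simp add: vec_eq_iff forall_3)
  qed
  then have "(P$3)\<^sup>2 * lorentz n n > 0" using q by (smt (verit) zero_le_power2)
  then show ?thesis by (simp add: zero_less_mult_iff)
qed

lemma lcross_norm: "X \<in> H2 \<Longrightarrow> Y \<in> H2 \<Longrightarrow> lorentz (lcross X Y) (lcross X Y) = (lorentz X Y)\<^sup>2 - 1"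
  by (simp add: lorentz_lcross_lcross H2_def power2_eq_square lorentz_commute[of Y X])

lemma lcross_norm_pos:
  assumes "X \<in> H2" "Y \<in> H2" "X \<noteq> Y"
  shows "lorentz (lcross X Y) (lcross X Y) > 0"
proof -
  have "lorentz X Y < -1"
    using lorentz_le_minus_one[OF assms(1,2)] lorentz_eq_minus_one[OF assms(1,2)] assms(3) by force
  then have "1 * 1 < (- lorentz X Y) * (- lorentz X Y)" by (intro mult_strict_mono) auto
  then have "(lorentz X Y)\<^sup>2 > 1" by (simp add: power2_eq_square)
  then show ?thesis using lcross_norm[OF assms(1,2)] by simp
qed

lemma hline_unique:
  assumes "hline L" "hline L'" "X \<noteq> Y" "X \<in> L" "Y \<in> L" "X \<in> L'" "Y \<in> L'"
  shows "L = L'"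
proof -
  have *: "M = {Z \<in> H2. lorentz (lcross X Y) Z = 0}" if M: "hline M" "X \<in> M" "Y \<in> M" for M
  proof -
    obtain n where n: "lorentz n n > 0" "M = {X \<in> H2. lorentz n X = 0}"
      using M(1) by (auto simp: hline_def)
    let ?c = "lcross X Y"
    have XY: "X \<in> H2" "Y \<in> H2" "lorentz X n = 0" "lorentz Y n = 0"
      using M n by (auto simp: lorentz_commute)
    have c: "lorentz ?c ?c > 0" using lcross_norm_pos XY assms(3) by blast
    \<comment> \<open>In the expansion with respect to \<open>X\<close>, \<open>Y\<close>,
      \<open>?c\<close> only the last term survives, so every such normal is a multiple of
      \<open>?c\<close>.\<close>
    have e: "lorentz ?c ?c *\<^sub>R n = lorentz ?c n *\<^sub>R ?c"
      using lcross_expand_dual[of X Y ?c n] XY by simp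
    have nz: "lorentz ?c n \<noteq> 0"
    proof
      assume "lorentz ?c n = 0"
      with e c have "n = 0" by simp
      with n(1) show False by (simp add: lorentz_linear)
    qed
    have "lorentz ?c ?c * lorentz n Z = lorentz ?c n * lorentz ?c Z" for Z
      using arg_cong[OF e, of "\<lambda>v. lorentz v Z"] by (simp add: lorentz_linear)
    then have "lorentz n Z = 0 \<longleftrightarrow> lorentz ?c Z = 0" for Z
      using c nz by (metis less_irrefl mult_eq_0_iff)
    with n(2) show ?thesis by auto
  qed
  show ?thesis using *[of L] *[of L'] assms by simp
qed

lemma htriangle_det:
  assumes "htriangle A B C"
  shows "lorentz (lcross A B) C \<noteq> 0"
proof
  assume 0: "lorentz (lcross A B) C = 0"
  have H: "A \<in> H2" "B \<in> H2" "C \<in> H2" using assms by (auto simp: htriangle_def)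
  have no: "lorentz n C \<noteq> 0" if "lorentz n n > 0" "lorentz n A = 0" "lorentz n B = 0" for n
  proof
    assume "lorentz n C = 0"
    with that H have "hline {X \<in> H2. lorentz n X = 0} \<and> {A, B, C} \<subseteq> {X \<in> H2. lorentz n X = 0}"
      unfolding hline_def by blast
    with assms show False unfolding htriangle_def by blast
  qed
  \<comment> \<open>Should all three vertices coincide, any line through the point is a
    contradiction; this normal has square \<open>1 + (A$1)\<^sup>2\<close>.\<close>
  let ?n = "lcross A (axis 1 1)"
  have "lorentz A A = -1" using H by (simp add: H2_def)
  then have "lorentz ?n ?n = 1 + (A$1)\<^sup>2"
    unfolding lorentz_lcross_lcross by (simp add: lorentz_def axis_def power2_eq_square)
  then have "lorentz ?n ?n > 0" by (smt (verit) zero_le_power2)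
  from no[OF this] have "A \<noteq> B \<or> A \<noteq> C" by auto
  then show False
    using no[of "lcross A B"] no[of "lcross A C"] lcross_norm_pos[of A B] lcross_norm_pos[of A C] H 0
    by (cases "A = B") auto
qed

section \<open>Distances, bisectors and tangent circles\<close>

lemma cosh_hdist: "X \<in> H2 \<Longrightarrow> Y \<in> H2 \<Longrightarrow> cosh (hdist X Y) = - lorentz X Y"
  using lorentz_le_minus_one[of X Y] by (simp add: hdist_def cosh_arcosh_real)

lemma hdist_nonneg: "X \<in> H2 \<Longrightarrow> Y \<in> H2 \<Longrightarrow> hdist X Y \<ge> 0"
  using lorentz_le_minus_one[of X Y] by (simp add: hdist_def arcosh_nonneg_real)

lemma hdist_le_iff:
  assumes "X \<in> H2" "Y \<in> H2" "Z \<in> H2" "W \<in> H2"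
  shows "hdist X Y \<le> hdist Z W \<longleftrightarrow> lorentz Z W \<le> lorentz X Y"
proof -
  have "hdist X Y \<le> hdist Z W \<longleftrightarrow> cosh (hdist X Y) \<le> cosh (hdist Z W)"
    using hdist_nonneg assms by (simp add: cosh_real_nonneg_le_iff)
  then show ?thesis using assms by (simp add: cosh_hdist)
qed

lemma hdist_eq_iff:
  assumes "X \<in> H2" "Y \<in> H2" "r \<ge> 0"
  shows "hdist X Y = r \<longleftrightarrow> lorentz X Y = - cosh r"
  using assms cosh_hdist[of X Y] hdist_nonneg[of X Y] arcosh_cosh_real[of r]
  by (auto simp: hdist_def)

definition hbisector :: "real ^ 3 \<Rightarrow> real ^ 3 \<Rightarrow> (real ^ 3) set" where
  "hbisector K Q = {X \<in> H2. lorentz (Q - K) X = 0}"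

lemma diff_H2_spacelike:
  assumes "K \<in> H2" "Q \<in> H2" "K \<noteq> Q"
  shows "lorentz (Q - K) (Q - K) > 0"
proof -
  have "lorentz K Q < -1"
    using lorentz_le_minus_one[OF assms(1,2)] lorentz_eq_minus_one[OF assms(1,2)] assms(3) by force
  then show ?thesis using assms by (simp add: lorentz_linear H2_def lorentz_commute[of Q K])
qed

lemma hline_hbisector: "K \<in> H2 \<Longrightarrow> Q \<in> H2 \<Longrightarrow> K \<noteq> Q \<Longrightarrow> hline (hbisector K Q)"
  using diff_H2_spacelike by (auto simp: hline_def hbisector_def)

text \<open>A point of the bisector and its mirror image in the line \<open>KQ\<close> are equidistant from \<open>K\<close>,
  so a circle about \<open>K\<close> can touch the bisector only at the midpoint of \<open>KQ\<close>.\<close>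

lemma tangent_bisector_radius:
  assumes K: "K \<in> H2" and Q: "Q \<in> H2" and r: "r > 0"
    and X: "hcircle K r \<inter> hbisector K Q = {X}"
  shows "lorentz K Q = 1 - 2 * (cosh r)\<^sup>2"
proof -
  define m where "m = K + Q"
  define c where "c = lorentz K Q"
  have c: "c \<le> -1" using lorentz_le_minus_one[OF K Q] by (simp add: c_def)
  have KK: "lorentz K K = -1" "lorentz Q Q = -1" "lorentz Q K = c" "lorentz K Q = c"
    using K Q by (auto simp: H2_def c_def lorentz_commute)
  have X_in: "X \<in> hcircle K r" "X \<in> hbisector K Q" using X by auto
  then have XH: "X \<in> H2" "lorentz X X = -1" by (auto simp: hcircle_def H2_def)
  have XK: "lorentz X K = - cosh r"
    using X_in hdist_eq_iff[OF K XH(1)] r by (simp add: hcircle_def lorentz_commute)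
  have XQ: "lorentz X Q = - cosh r"
    using X_in XK by (simp add: hbisector_def lorentz_linear lorentz_commute)
  have mm: "lorentz m m = 2 * c - 2" by (simp add: m_def lorentz_linear KK)
  have Xm: "lorentz X m = - 2 * cosh r" by (simp add: m_def lorentz_linear XK XQ)
  define t where "t = lorentz X m / lorentz m m"
  \<comment> \<open>The half-turn about the midpoint of \<open>KQ\<close> swaps \<open>K\<close> and
    \<open>Q\<close>; on the bisector it agrees with the mirror image in the line
    \<open>KQ\<close>.\<close>
  define X' where "X' = (2 * t) *\<^sub>R m - X"
  have tm: "t * (2 * c - 2) = lorentz X m" using mm c by (simp add: t_def)
  have "lorentz X' X' = 4 * t * (t * (2 * c - 2)) - 4 * t * lorentz X m - 1"
    by (simp add: X'_def lorentz_linear lorentz_commute[of m X] mm XH algebra_simps)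
  then have "lorentz X' X' = -1" by (simp add: tm)
  moreover have X'K: "lorentz X' K = - cosh r"
    using tm by (simp add: X'_def lorentz_linear XK) (simp add: m_def lorentz_linear KK XK XQ algebra_simps)
  moreover have X'Q: "lorentz X' Q = - cosh r"
    using tm by (simp add: X'_def lorentz_linear XQ) (simp add: m_def lorentz_linear KK XK XQ algebra_simps)
  ultimately have X'H: "X' \<in> H2" using H2_same_sheet[OF K, of X'] cosh_real_pos[of r] by simp
  have "X' \<in> hcircle K r \<inter> hbisector K Q"
    using X'H X'K X'Q hdist_eq_iff[OF K X'H] r
    by (simp add: hcircle_def hbisector_def lorentz_linear lorentz_commute)
  then have "X' = X" using X by simp
  then have "2 *\<^sub>R X = 2 *\<^sub>R (t *\<^sub>R m)" by (simp add: X'_def scaleR_2 algebra_simps)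
  then have Xt: "X = t *\<^sub>R m" by (rule scaleR_left_imp_eq[rotated]) simp
  have "lorentz X K = t * (c - 1)" unfolding Xt by (simp add: lorentz_linear m_def KK)
  then have 1: "t * (1 - c) = cosh r" using XK by (simp add: algebra_simps)
  have "lorentz X X = t * t * (2 * c - 2)" unfolding Xt by (simp add: lorentz_linear mm)
  then have 2: "2 * (t * t * (1 - c)) = 1" using XH by (simp add: algebra_simps)
  have "2 * (cosh r)\<^sup>2 = 2 * (t * t * (1 - c)) * (1 - c)"
    unfolding 1[symmetric] by (simp add: power2_eq_square)
  then have "2 * (cosh r)\<^sup>2 = 1 - c" unfolding 2 by simp
  then show ?thesis by (simp add: c_def)
qed

text \<open>The hypothesis reads \<open>cosh (hdist K Q) = cosh (2 * r)\<close>, so the midpoint of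
  \<open>KQ\<close> is at distance \<open>r\<close> from \<open>K\<close>.\<close>

lemma tangent_bisector:
  assumes K: "K \<in> H2" and Q: "Q \<in> H2" and r: "r > 0" and rc: "lorentz K Q = 1 - 2 * (cosh r)\<^sup>2"
  obtains M where "hcircle K r \<inter> hbisector K Q = {M}" "M \<in> H2"
    and "\<exists>t>0. M = t *\<^sub>R (K + Q)"
proof -
  have ch: "cosh r > 0" by (rule cosh_real_pos)
  \<comment> \<open>The normalising factor: \<open>K + Q\<close> has square
    \<open>- 4 * (cosh r)\<^sup>2\<close>.\<close>
  define t where "t = 1 / (2 * cosh r)"
  define M where "M = t *\<^sub>R (K + Q)"
  have KK: "lorentz K K = -1" "lorentz Q Q = -1" "lorentz Q K = 1 - 2 * (cosh r)\<^sup>2"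
    using K Q rc by (auto simp: H2_def lorentz_commute)
  have t: "t > 0" "2 * t * cosh r = 1" using ch by (simp_all add: t_def)
  have MM: "lorentz M M = -1"
  proof -
    have "lorentz M M = - (2 * t * cosh r)\<^sup>2"
      by (simp add: M_def lorentz_linear KK rc power2_eq_square algebra_simps)
    then show ?thesis using t by simp
  qed
  have MK: "lorentz M K = - cosh r"
  proof -
    have "lorentz M K = - (2 * t * cosh r) * cosh r"
      by (simp add: M_def lorentz_linear KK rc power2_eq_square algebra_simps)
    then show ?thesis using t by simp
  qed
  have MQ: "lorentz M Q = - cosh r"
  proof -
    have "lorentz M Q = - (2 * t * cosh r) * cosh r"
      by (simp add: M_def lorentz_linear KK rc power2_eq_square algebra_simps)
    then show ?thesis using t by simp
  qed
  have MH: "M \<in> H2" using H2_same_sheet[OF K MM] MK ch by simp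
  have "X = M" if "X \<in> hcircle K r \<inter> hbisector K Q" for X
  proof -
    have X: "X \<in> H2" "lorentz K X = - cosh r" "lorentz Q X = - cosh r"
      using that hdist_eq_iff[of K X r] K r by (auto simp: hcircle_def hbisector_def lorentz_linear)
    have "lorentz M X = - (2 * t * cosh r)"
      by (simp add: M_def lorentz_linear X)
    then show ?thesis using lorentz_eq_minus_one[OF MH X(1)] t by simp
  qed
  moreover have "M \<in> hcircle K r \<inter> hbisector K Q"
    using MH MK MQ hdist_eq_iff[OF K MH] r
    by (simp add: hcircle_def hbisector_def lorentz_linear lorentz_commute)
  ultimately have "hcircle K r \<inter> hbisector K Q = {M}" by blast
  with that MH t show ?thesis by (auto simp: M_def)
qed

section \<open>Words in reflections\<close>

definition hrefl :: "real ^ 3 \<Rightarrow> real ^ 3 \<Rightarrow> real ^ 3" where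
  "hrefl n X = X - (2 * lorentz n X) *\<^sub>R n"

lemma hrefl_linear:
  "hrefl n (X + Y) = hrefl n X + hrefl n Y"
  "hrefl n (a *\<^sub>R X) = a *\<^sub>R hrefl n X"
  by (simp_all add: hrefl_def lorentz_linear algebra_simps)

lemma hrefl_orthogonal: "lorentz n X = 0 \<Longrightarrow> hrefl n X = X"
  by (simp add: hrefl_def)

lemma hrefl_self: "lorentz n n = 1 \<Longrightarrow> hrefl n n = - n"
  by (simp add: hrefl_def scaleR_2)

lemma hrefl_hrefl: "lorentz n n = 1 \<Longrightarrow> hrefl n (hrefl n X) = X"
  by (simp add: hrefl_def lorentz_linear)

lemma lorentz_hrefl_adjoint: "lorentz (hrefl n X) Y = lorentz X (hrefl n Y)"
  by (simp add: hrefl_def lorentz_linear lorentz_commute[of X n])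

lemma hrefl_H2:
  assumes "lorentz n n = 1" "X \<in> H2"
  shows "hrefl n X \<in> H2"
proof (rule H2_same_sheet[OF assms(2)])
  show "lorentz (hrefl n X) (hrefl n X) = -1"
    using assms by (simp add: lorentz_hrefl_adjoint hrefl_hrefl H2_def)
  show "lorentz (hrefl n X) X < 0"
  proof -
    have "lorentz (hrefl n X) X = - 1 - 2 * (lorentz n X * lorentz n X)"
      using assms(2) by (simp add: hrefl_def lorentz_linear H2_def)
    then show ?thesis using zero_le_square[of "lorentz n X"] by linarith
  qed
qed

text \<open>Built from the last letter because that letter acts first; \<open>alt s t k\<close> is
  meant to act on \<open>\<alpha> s\<close>, so it ends in \<open>t\<close>.\<close>

primrec alt :: "'i \<Rightarrow> 'i \<Rightarrow> nat \<Rightarrow> 'i list" where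
  "alt s t 0 = []"
| "alt s t (Suc k) = alt t s k @ [t]"

lemma length_alt [simp]: "length (alt s t k) = k"
  by (induction k arbitrary: s t) auto

lemma set_alt: "set (alt s t k) \<subseteq> {s, t}"
proof (induction k arbitrary: s t)
  case (Suc k)
  then show ?case using Suc.IH[of t s] by auto
qed simp

lemma alt_suffix: "k \<le> n \<Longrightarrow> \<exists>u. alt s t n = u @ alt s t k"
proof (induction k arbitrary: s t n)
  case (Suc k)
  then obtain n' where n: "n = Suc n'" "k \<le> n'" by (cases n) auto
  with Suc.IH[of n' t s] show ?case by auto
qed simp

text \<open>The Gram matrix is that of a Coxeter group. The sign of a root is read off from its
  product with a vector of the closed chamber, not from coordinates.\<close>

locale reflection_roots =
  fixes \<alpha> :: "'i \<Rightarrow> real ^ 3" and m :: "'i \<Rightarrow> 'i \<Rightarrow> nat"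
  assumes root_unit [simp]: "lorentz (\<alpha> i) (\<alpha> i) = 1"
    and root_angle: "i \<noteq> j \<Longrightarrow> lorentz (\<alpha> i) (\<alpha> j) = - cos (pi / real (m i j))"
    and order_ge_2: "i \<noteq> j \<Longrightarrow> 2 \<le> m i j"
begin

section \<open>Words as group elements with a sign\<close>

primrec refls :: "'i list \<Rightarrow> real ^ 3 \<Rightarrow> real ^ 3" where
  "refls [] X = X"
| "refls (i # w) X = hrefl (\<alpha> i) (refls w X)"

lemma refls_append [simp]: "refls (u @ v) X = refls u (refls v X)"
  by (induction u) auto

lemma refls_linear:
  "refls w (X + Y) = refls w X + refls w Y"
  "refls w (a *\<^sub>R X) = a *\<^sub>R refls w X"
  by (induction w) (simp_all add: hrefl_linear)

lemma refls_minus: "refls w (- X) = - refls w X" "refls w (X - Y) = refls w X - refls w Y"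
  using refls_linear(2)[of w "-1" X] refls_linear(1)[of w X "- Y"] refls_linear(2)[of w "-1" Y]
  by simp_all

lemma refls_orthogonal: "(\<And>i. i \<in> set w \<Longrightarrow> lorentz (\<alpha> i) X = 0) \<Longrightarrow> refls w X = X"
  by (induction w) (auto simp: hrefl_orthogonal)

lemma refls_rev: "refls (rev w) (refls w X) = X"
  by (induction w arbitrary: X) (auto simp: hrefl_hrefl)

lemma refls_H2: "X \<in> H2 \<Longrightarrow> refls w X \<in> H2"
  by (induction w) (auto simp: hrefl_H2)

text \<open>Equality of group elements together with their sign. Carrying the parity along replaces
  the determinant homomorphism.\<close>

definition weq :: "'i list \<Rightarrow> 'i list \<Rightarrow> bool" where
  "weq u v \<longleftrightarrow> refls u = refls v \<and> even (length u + length v)"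

definition reduced :: "'i list \<Rightarrow> bool" where
  "reduced w \<longleftrightarrow> (\<forall>u. weq u w \<longrightarrow> length w \<le> length u)"

lemma weq_sym: "weq u v \<Longrightarrow> weq v u"
  by (simp add: weq_def add.commute)

lemma weq_trans [trans]: "weq u v \<Longrightarrow> weq v w \<Longrightarrow> weq u w"
  by (auto simp: weq_def)

lemma weq_append: "weq u u' \<Longrightarrow> weq v v' \<Longrightarrow> weq (u @ v) (u' @ v')"
  by (auto simp: weq_def fun_eq_iff)

lemma weq_refl [simp]: "weq u u"
  by (simp add: weq_def)

lemma weq_cancel: "weq (u @ [s, s] @ v) (u @ v)"
  by (auto simp: weq_def fun_eq_iff hrefl_hrefl)

lemma exists_reduced: "\<exists>v. reduced v \<and> weq v w"
proof -
  have "weq w w" by simp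
  from ex_has_least_nat[of "\<lambda>v. weq v w", OF this, of length]
  obtain v where v: "weq v w" "\<And>u. weq u w \<Longrightarrow> length v \<le> length u" by blast
  then have "reduced v" using weq_trans[OF _ v(1)] by (auto simp: reduced_def)
  with v(1) show ?thesis by blast
qed

lemma reduced_appendD:
  assumes "reduced (u @ v)"
  shows "reduced u"
  unfolding reduced_def
proof (intro allI impI)
  fix u' assume "weq u' u"
  then have "weq (u' @ v) (u @ v)" by (simp add: weq_append)
  with assms show "length u \<le> length u'" by (fastforce simp: reduced_def)
qed

text \<open>The coefficients are Chebyshev values, multiplied by \<open>sin \<theta>\<close> to
  avoid division. Both orders of the letters are treated together because removing a letter
  exchanges them.\<close>

lemma refls_alt_root:
  assumes "s \<noteq> t" and \<theta>: "\<theta> = pi / real (m s t)"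
  shows "sin \<theta> *\<^sub>R refls (alt s t k) (\<alpha> s) =
      sin (real (k + 1) * \<theta>) *\<^sub>R \<alpha> (if even k then s else t) +
      sin (real k * \<theta>) *\<^sub>R \<alpha> (if even k then t else s) \<and>
    sin \<theta> *\<^sub>R refls (alt t s k) (\<alpha> t) =
      sin (real (k + 1) * \<theta>) *\<^sub>R \<alpha> (if even k then t else s) +
      sin (real k * \<theta>) *\<^sub>R \<alpha> (if even k then s else t)"
proof (induction k rule: less_induct)
  case (less k)
  have c: "lorentz (\<alpha> s) (\<alpha> t) = - cos \<theta>" "lorentz (\<alpha> t) (\<alpha> s) = - cos \<theta>"
    using root_angle[OF assms(1)] \<theta> by (simp_all add: lorentz_commute)
  have st: "hrefl (\<alpha> t) (\<alpha> s) = \<alpha> s + (2 * cos \<theta>) *\<^sub>R \<alpha> t"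
    "hrefl (\<alpha> s) (\<alpha> t) = \<alpha> t + (2 * cos \<theta>) *\<^sub>R \<alpha> s"
    by (simp_all add: hrefl_def c)
  have rec: "sin (x + 2 * \<theta>) = 2 * cos \<theta> * sin (x + \<theta>) - sin x" for x
  proof -
    have "sin ((x + \<theta>) + \<theta>) + sin ((x + \<theta>) - \<theta>) = 2 * cos \<theta> * sin (x + \<theta>)"
      unfolding sin_add[of "x + \<theta>" \<theta>] sin_diff[of "x + \<theta>" \<theta>] by simp
    then show ?thesis by (simp add: algebra_simps)
  qed
  consider "k = 0" | "k = 1" | j where "k = Suc (Suc j)" by (metis One_nat_def not0_implies_Suc)
  then show ?case
  proof cases
    case 1 then show ?thesis by simp
  next
    case 2 then show ?thesis using st sin_double[of \<theta>] by (simp add: algebra_simps)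
  next
    case 3
    let ?S = "\<lambda>n. sin (real n * \<theta>)"
    have r: "?S (j + 2) = 2 * cos \<theta> * ?S (j + 1) - ?S j"
      "?S (j + 3) = 2 * cos \<theta> * ?S (j + 2) - ?S (j + 1)"
      using rec[of "real j * \<theta>"] rec[of "real (j + 1) * \<theta>"] by (simp_all add: algebra_simps)
    \<comment> \<open>The last letter \<open>t\<close> adds \<open>2 cos \<theta>\<close> times
      \<open>\<alpha> t\<close>; the \<open>s\<close> before it merely negates
      \<open>\<alpha> s\<close>. This is the recurrence \<open>rec\<close> of the sines.\<close>
    have a: "refls (alt s t k) (\<alpha> s) = (2 * cos \<theta>) *\<^sub>R refls (alt t s (j + 1)) (\<alpha> t) - refls (alt s t j) (\<alpha> s)"
      "refls (alt t s k) (\<alpha> t) = (2 * cos \<theta>) *\<^sub>R refls (alt s t (j + 1)) (\<alpha> s) - refls (alt t s j) (\<alpha> t)"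
      using 3 st by (simp_all add: refls_linear hrefl_linear hrefl_self refls_minus)
    have IH: "j < k" "j + 1 < k" using 3 by auto
    note i = less.IH[OF IH(1)] less.IH[OF IH(2)]
    have k: "real (k + 1) = real (j + 3)" "real k = real (j + 2)" "even k = even j" "even (j + 1) = odd j"
      using 3 by auto
    have b: "sin \<theta> *\<^sub>R refls (alt s t k) (\<alpha> s) = (2 * cos \<theta>) *\<^sub>R (sin \<theta> *\<^sub>R refls (alt t s (j + 1)) (\<alpha> t)) - sin \<theta> *\<^sub>R refls (alt s t j) (\<alpha> s)"
      "sin \<theta> *\<^sub>R refls (alt t s k) (\<alpha> t) = (2 * cos \<theta>) *\<^sub>R (sin \<theta> *\<^sub>R refls (alt s t (j + 1)) (\<alpha> s)) - sin \<theta> *\<^sub>R refls (alt t s j) (\<alpha> t)"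
      unfolding a by (simp_all add: scaleR_diff_right mult.commute)
    have j2: "real (j + 1 + 1) = real (j + 2)" by simp
    show ?thesis
      unfolding b i[THEN conjunct1] i[THEN conjunct2] k r j2 if_distrib[of "\<lambda>b. \<not> b"]
      by (cases "even j") (simp_all add: algebra_simps)
  qed
qed

text \<open>Both sides agree on \<open>\<alpha> s\<close> and \<open>\<alpha> t\<close>, which they
  send to negatives of these roots, and both fix the orthogonal complement.\<close>

lemma refls_alt_braid:
  assumes "s \<noteq> t"
  shows "refls (alt s t (m s t)) = refls (alt t s (m s t))"
proof
  fix X
  define \<theta> where "\<theta> = pi / real (m s t)"
  obtain n where n: "m s t = Suc n" using order_ge_2[OF assms] by (cases "m s t") auto
  have m\<theta>: "real (Suc n) * \<theta> = pi" using n by (simp add: \<theta>_def)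
  have \<theta>0: "0 < \<theta>" "\<theta> < pi" using order_ge_2[OF assms] by (simp_all add: \<theta>_def divide_less_eq)
  then have s0: "sin \<theta> > 0" by (rule sin_gt_zero)
  have sn: "sin (real n * \<theta>) = sin \<theta>" "sin (real (n + 1) * \<theta>) = 0" "sin (real (Suc n + 1) * \<theta>) = - sin \<theta>"
    "sin (real (Suc n) * \<theta>) = 0"
  proof -
    have "real n * \<theta> = pi - \<theta>" using m\<theta> by (simp add: algebra_simps)
    then show "sin (real n * \<theta>) = sin \<theta>" by simp
    have "real (Suc n + 1) * \<theta> = pi + \<theta>" using m\<theta> by (simp add: algebra_simps)
    then show "sin (real (Suc n + 1) * \<theta>) = - sin \<theta>" by simp
    show "sin (real (n + 1) * \<theta>) = 0" "sin (real (Suc n) * \<theta>) = 0" using m\<theta> by simp_all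
  qed
  have U: "refls (alt s t n) (\<alpha> s) = \<alpha> (if even n then t else s)"
    "refls (alt t s n) (\<alpha> t) = \<alpha> (if even n then s else t)"
    using refls_alt_root[OF assms \<theta>_def, of n] s0 unfolding sn by simp_all
  have V: "refls (alt s t (Suc n)) (\<alpha> s) = - \<alpha> (if even n then t else s)"
    "refls (alt t s (Suc n)) (\<alpha> t) = - \<alpha> (if even n then s else t)"
    using refls_alt_root[OF assms \<theta>_def, of "Suc n"] s0 unfolding sn
    by (simp_all flip: scaleR_minus_right)
  have roots: "refls (alt s t (m s t)) (\<alpha> s) = refls (alt t s (m s t)) (\<alpha> s)"
    "refls (alt s t (m s t)) (\<alpha> t) = refls (alt t s (m s t)) (\<alpha> t)"
    unfolding n V using U by (simp_all add: hrefl_self refls_minus)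
  define c where "c = cos \<theta>"
  have c: "lorentz (\<alpha> s) (\<alpha> t) = - c" "lorentz (\<alpha> t) (\<alpha> s) = - c"
    using root_angle[OF assms] by (simp_all add: lorentz_commute c_def \<theta>_def)
  have "c\<^sup>2 + (sin \<theta>)\<^sup>2 = 1" by (simp add: c_def)
  then have c1: "1 - c * c > 0" using s0 by (smt (verit) power2_eq_square zero_less_power)
  \<comment> \<open>The Gram system for the projection to the plane of the two roots; its
    determinant \<open>1 - c * c\<close> is \<open>sin\<^sup>2 \<theta>\<close>.\<close>
  define p where "p = (lorentz (\<alpha> s) X + c * lorentz (\<alpha> t) X) / (1 - c * c)"
  define q where "q = (lorentz (\<alpha> t) X + c * lorentz (\<alpha> s) X) / (1 - c * c)"
  define Z where "Z = X - p *\<^sub>R \<alpha> s - q *\<^sub>R \<alpha> t"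
  have "lorentz (\<alpha> s) Z = 0" "lorentz (\<alpha> t) Z = 0"
    using c1 by (simp_all add: Z_def lorentz_linear c p_def q_def divide_simps) (simp_all add: algebra_simps)
  then have Z: "refls (alt s t (m s t)) Z = Z" "refls (alt t s (m s t)) Z = Z"
    using set_alt[of s t "m s t"] set_alt[of t s "m s t"] by (auto intro!: refls_orthogonal)
  have X: "X = Z + p *\<^sub>R \<alpha> s + q *\<^sub>R \<alpha> t" by (simp add: Z_def)
  show "refls (alt s t (m s t)) X = refls (alt t s (m s t)) X"
    unfolding X refls_linear Z roots ..
qed

lemma reduced_alternating:
  assumes "reduced x" "set x \<subseteq> {s, t}" "x = [] \<or> last x = t" "s \<noteq> t"
  shows "x = alt s t (length x)"
  using assms
proof (induction x arbitrary: s t rule: rev_induct)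
  case (snoc r x)
  then have r: "r = t" by simp
  have "x = [] \<or> last x = s"
  proof (rule ccontr)
    assume "\<not> ?thesis"
    then obtain y where y: "x = y @ [t]" using snoc.prems(2)
      by (cases x rule: rev_cases) auto
    have "weq y (x @ [r])" using weq_sym[OF weq_cancel[of y t "[]"]] y r weq_sym by simp
    with snoc.prems(1) y show False by (auto simp: reduced_def)
  qed
  then have "x = alt t s (length x)"
    using snoc.IH[of t s] snoc.prems reduced_appendD[of x "[r]"] by auto
  then show ?case using r by (metis alt.simps(2) length_append_singleton)
qed simp

text \<open>By parity the last hypothesis means that appending \<open>s\<close> strictly increases
  the length. This forces \<open>length x < m s t\<close>, so both angles in
  \<open>refls_alt_root\<close> stay in \<open>[0, pi]\<close>.\<close>

lemma dihedral_root:
  assumes st: "s \<noteq> t" and x: "reduced x" "set x \<subseteq> {s, t}"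
    and xs: "\<And>u. weq u (x @ [s]) \<Longrightarrow> length x \<le> length u"
  shows "\<exists>p q. 0 \<le> p \<and> 0 \<le> q \<and> refls x (\<alpha> s) = p *\<^sub>R \<alpha> s + q *\<^sub>R \<alpha> t"
proof -
  define k where "k = length x"
  have "x = [] \<or> last x = t"
  proof (rule ccontr)
    assume "\<not> ?thesis"
    then obtain y where y: "x = y @ [s]" using x(2) by (cases x rule: rev_cases) auto
    have "weq y (x @ [s])" using weq_sym[OF weq_cancel[of y s "[]"]] y by simp
    from xs[OF this] y show False by simp
  qed
  then have xk: "x = alt s t k" using reduced_alternating x st by (simp add: k_def)
  \<comment> \<open>From length \<open>m s t\<close> on, the braid relation could make the word end
    in \<open>s\<close>, and the appended \<open>s\<close> would cancel.\<close>
  have km: "k < m s t"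
  proof (rule ccontr)
    assume "\<not> ?thesis"
    then obtain u where u: "alt s t k = u @ alt s t (m s t)"
      using alt_suffix[of "m s t" k s t] by auto
    obtain n where n: "m s t = Suc n" using order_ge_2[OF st] by (cases "m s t") auto
    have "weq (x @ [s]) (u @ alt t s (m s t) @ [s])"
      using refls_alt_braid[OF st] xk u by (simp add: weq_def fun_eq_iff)
    moreover have "weq (u @ alt t s (m s t) @ [s]) (u @ alt s t n)"
      using weq_cancel[of "u @ alt s t n" s "[]"] n by simp
    ultimately have "weq (u @ alt s t n) (x @ [s])" using weq_trans weq_sym by blast
    from xs[OF this] u n show False by (metis k_def length_alt length_append add_Suc_right not_less_eq_eq order_refl)
  qed
  define \<theta> where "\<theta> = pi / real (m s t)"
  have m0: "real (m s t) > 1" using order_ge_2[OF st] by simp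
  have "sin \<theta> > 0" using m0 by (intro sin_gt_zero) (simp_all add: \<theta>_def divide_less_eq)
  have "sin (real j * \<theta>) \<ge> 0" if "j \<le> m s t" for j
  proof (rule sin_ge_zero)
    show "real j * \<theta> \<le> pi" using that m0 by (simp add: \<theta>_def divide_le_eq)
  qed (use m0 in \<open>simp add: \<theta>_def\<close>)
  from this[of "k + 1"] this[of k]
  have nn: "sin (real (k + 1) * \<theta>) / sin \<theta> \<ge> 0" "sin (real k * \<theta>) / sin \<theta> \<ge> 0"
    using km \<open>sin \<theta> > 0\<close> by simp_all
  define p where "p = sin (real (k + 1) * \<theta>) / sin \<theta>"
  define q where "q = sin (real k * \<theta>) / sin \<theta>"
  have "refls x (\<alpha> s) = (1 / sin \<theta>) *\<^sub>R (sin \<theta> *\<^sub>R refls (alt s t k) (\<alpha> s))"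
    using \<open>sin \<theta> > 0\<close> xk by simp
  also have "\<dots> = p *\<^sub>R \<alpha> (if even k then s else t) + q *\<^sub>R \<alpha> (if even k then t else s)"
    unfolding refls_alt_root[OF st \<theta>_def, THEN conjunct1] p_def q_def by (simp add: scaleR_add_right)
  finally have "refls x (\<alpha> s) = p *\<^sub>R \<alpha> s + q *\<^sub>R \<alpha> t \<or> refls x (\<alpha> s) = q *\<^sub>R \<alpha> s + p *\<^sub>R \<alpha> t"
    by (cases "even k") simp_all
  then show ?thesis using nn unfolding p_def[symmetric] q_def[symmetric] by blast
qed

text \<open>Tits' argument: split off a maximal suffix in the letters \<open>s\<close>, \<open>t\<close>, where \<open>t\<close> is the last
  letter of \<open>w\<close>; the remaining prefix is shorter than \<open>w\<close>, and the suffix sends \<open>\<alpha> s\<close> into the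
  cone of \<open>\<alpha> s\<close> and \<open>\<alpha> t\<close>.\<close>

lemma reduced_root_nonneg:
  assumes Y: "\<And>i. 0 \<le> lorentz Y (\<alpha> i)"
    and "reduced w" "\<And>u. weq u (w @ [s]) \<Longrightarrow> length w \<le> length u"
  shows "0 \<le> lorentz Y (refls w (\<alpha> s))"
  using assms(2,3)
proof (induction "length w" arbitrary: w s rule: less_induct)
  case less
  show ?case
  proof (cases w rule: rev_cases)
    case Nil
    then show ?thesis using Y by simp
  next
    case (snoc w' t)
    have st: "s \<noteq> t"
    proof
      assume "s = t"
      then have "weq w' (w @ [s])" using weq_sym[OF weq_cancel[of w' s "[]"]] snoc by simp
      from less.prems(2)[OF this] snoc show False by simp
    qed
    \<comment> \<open>The group element is split, not the word: \<open>v @ x\<close> need only be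
      \<open>weq\<close> to \<open>w\<close> at the same total length.\<close>
    define P where "P = (\<lambda>(v, x). weq (v @ x) w \<and> length v + length x = length w \<and> set x \<subseteq> {s, t})"
    have "P (w', [t])" using snoc by (simp add: P_def)
    from ex_has_least_nat[of P, OF this, of "length \<circ> fst"]
    obtain v x where vx: "P (v, x)" and least: "\<And>v' x'. P (v', x') \<Longrightarrow> length v \<le> length v'"
      by auto
    from vx have vxw: "weq (v @ x) w" and len: "length v + length x = length w" and x: "set x \<subseteq> {s, t}"
      by (auto simp: P_def)
    have lw: "length w \<le> length (v' @ x')" if "weq v' v" "weq x' x" for v' x'
      using less.prems(1) weq_trans[OF weq_append[OF that] vxw] unfolding reduced_def by blast
    have lws: "length w \<le> length u" if "weq u (v @ x @ [s])" for u
    proof -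
      have "weq (v @ x @ [s]) (w @ [s])" using weq_append[OF vxw weq_refl[of "[s]"]] by simp
      then show ?thesis using less.prems(2) weq_trans that by blast
    qed
    have v: "reduced v" using lw[OF _ weq_refl] len by (force simp: reduced_def)
    have rx: "reduced x" using lw[OF weq_refl] len by (force simp: reduced_def)
    have lv: "length v < length w" using least[OF \<open>P (w', [t])\<close>] snoc by simp
    \<comment> \<open>If \<open>r\<close> shortened \<open>v\<close>, moving \<open>r\<close> into
      the suffix would give an admissible pair with a shorter prefix.\<close>
    have ext: "length v \<le> length u" if r: "r \<in> {s, t}" and u: "weq u (v @ [r])" for u r
    proof (rule ccontr)
      assume lt: "\<not> length v \<le> length u"
      have "weq (u @ r # x) (v @ [r] @ r # x)" using weq_append[OF u weq_refl[of "r # x"]] by simp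
      moreover have "weq (v @ [r] @ r # x) (v @ x)" using weq_cancel[of v r x] by simp
      ultimately have e: "weq (u @ r # x) w" using vxw weq_trans by blast
      then have "length w \<le> length (u @ r # x)" using less.prems(1) unfolding reduced_def by blast
      with lt len have "length u + length (r # x) = length w" by simp
      with e x r have "P (u, r # x)" by (auto simp: P_def)
      from least[OF this] lt show False by simp
    qed
    have pos: "0 \<le> lorentz Y (refls v (\<alpha> r))" if "r \<in> {s, t}" for r
      using less.hyps[OF lv v] ext[OF that] by blast
    have "length x \<le> length u" if "weq u (x @ [s])" for u
      using lws[of "v @ u"] weq_append[OF weq_refl[of v] that] len by simp
    from dihedral_root[OF st rx x this]
    obtain p q where pq: "0 \<le> p" "0 \<le> q" "refls x (\<alpha> s) = p *\<^sub>R \<alpha> s + q *\<^sub>R \<alpha> t" by blast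
    have "refls w (\<alpha> s) = refls v (refls x (\<alpha> s))" using vxw by (auto simp: weq_def fun_eq_iff)
    also have "\<dots> = p *\<^sub>R refls v (\<alpha> s) + q *\<^sub>R refls v (\<alpha> t)" unfolding pq by (simp add: refls_linear)
    finally show ?thesis using pos pq by (simp add: lorentz_linear)
  qed
qed

text \<open>Appending \<open>s\<close> to \<open>w\<close> subtracts a nonnegative multiple of
  \<open>refls w (\<alpha> s)\<close> from the image of \<open>K\<close>, and that root is
  nonnegative on \<open>Y\<close>. Images therefore never approach \<open>Y\<close> along a reduced
  word.\<close>

lemma reduced_orbit_le:
  assumes Y: "\<And>i. 0 \<le> lorentz Y (\<alpha> i)" and K: "\<And>i. 0 \<le> lorentz K (\<alpha> i)"
    and "reduced (u @ v)"
  shows "lorentz Y (refls (u @ v) K) \<le> lorentz Y (refls u K)"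
  using assms(3)
proof (induction v rule: rev_induct)
  case (snoc s v)
  let ?w = "u @ v"
  have r: "reduced ?w" using snoc.prems reduced_appendD[of ?w "[s]"] by simp
  have "length ?w \<le> length x" if "weq x (?w @ [s])" for x
    using snoc.prems that by (fastforce simp: reduced_def)
  then have "0 \<le> lorentz Y (refls ?w (\<alpha> s))" using reduced_root_nonneg[OF Y r] by blast
  then have "0 \<le> lorentz K (\<alpha> s) * lorentz Y (refls ?w (\<alpha> s))" using K by simp
  moreover have "refls (?w @ [s]) K = refls ?w K - (2 * lorentz K (\<alpha> s)) *\<^sub>R refls ?w (\<alpha> s)"
    by (simp add: hrefl_def refls_minus refls_linear lorentz_commute)
  ultimately show ?case using snoc.IH[OF r] by (simp add: lorentz_linear)
qed simp

lemma orbit_le: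
  assumes Y: "\<And>i. 0 \<le> lorentz Y (\<alpha> i)" and K: "\<And>i. 0 \<le> lorentz K (\<alpha> i)"
  shows "lorentz Y (refls w K) \<le> lorentz Y K"
    and "odd (length w) \<Longrightarrow> \<exists>i. lorentz Y (refls w K) \<le> lorentz Y (hrefl (\<alpha> i) K)"
proof -
  obtain v where v: "reduced v" "weq v w" using exists_reduced by blast
  then have e: "refls w K = refls v K" "even (length v) = even (length w)" by (auto simp: weq_def)
  show "lorentz Y (refls w K) \<le> lorentz Y K"
    using reduced_orbit_le[OF Y K, of "[]" v] v e by simp
  assume "odd (length w)"
  then obtain i v' where "v = [i] @ v'" using e by (cases v) auto
  then show "\<exists>i. lorentz Y (refls w K) \<le> lorentz Y (hrefl (\<alpha> i) K)"
    using reduced_orbit_le[OF Y K, of "[i]" v'] v e by auto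
qed

text \<open>The even subgroup: a point outside the chamber that satisfies the finitely many conditions
  is mapped into the chamber by a single reflection.\<close>

lemma even_orbit_le:
  assumes K: "\<And>i. 0 < lorentz K (\<alpha> i)"
    and X: "\<And>i j. i \<noteq> j \<Longrightarrow> lorentz X (refls [i, j] K) \<le> lorentz X K"
    and w: "even (length w)"
  shows "lorentz X (refls w K) \<le> lorentz X K"
proof (cases "\<forall>i. 0 \<le> lorentz X (\<alpha> i)")
  case True
  then show ?thesis using orbit_le(1) K less_imp_le by blast
next
  case False
  then obtain i where i: "lorentz X (\<alpha> i) < 0" by (auto simp: not_le)
  define Y where "Y = hrefl (\<alpha> i) X"
  have Yi: "lorentz Y (\<alpha> i) = - lorentz X (\<alpha> i)"
    by (simp add: Y_def hrefl_def lorentz_linear lorentz_commute)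
  \<comment> \<open>Seen from \<open>Y\<close>, the hypotheses say that no
    \<open>s\<^sub>j K\<close> is nearer than \<open>s\<^sub>i K\<close>.\<close>
  have le: "lorentz Y (hrefl (\<alpha> j) K) \<le> lorentz Y (hrefl (\<alpha> i) K)" for j
    using X[of i j] by (cases "j = i") (simp_all add: Y_def lorentz_hrefl_adjoint hrefl_hrefl)
  have Y: "0 \<le> lorentz Y (\<alpha> j)" for j
  proof -
    \<comment> \<open>The product of \<open>Y\<close> with \<open>hrefl (\<alpha> j) K\<close> falls
      short of \<open>lorentz Y K\<close> by twice the right-hand side, and the left-hand side is
      positive.\<close>
    have "lorentz K (\<alpha> i) * lorentz Y (\<alpha> i) \<le> lorentz K (\<alpha> j) * lorentz Y (\<alpha> j)"
      using le[of j] by (simp add: hrefl_def lorentz_linear lorentz_commute)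
    moreover have "0 < lorentz K (\<alpha> i) * lorentz Y (\<alpha> i)" using K[of i] i Yi by (simp add: mult_pos_neg)
    ultimately have "0 < lorentz K (\<alpha> j) * lorentz Y (\<alpha> j)" by linarith
    then show ?thesis using K[of j] by (simp add: zero_less_mult_iff)
  qed
  obtain j where "lorentz Y (refls (i # w) K) \<le> lorentz Y (hrefl (\<alpha> j) K)"
    using orbit_le(2)[OF Y, of K "i # w"] K w less_imp_le by auto
  with le[of j] have "lorentz Y (refls (i # w) K) \<le> lorentz Y (hrefl (\<alpha> i) K)" by simp
  then show ?thesis by (simp add: Y_def lorentz_hrefl_adjoint hrefl_hrefl)
qed

end

section \<open>The cell of a triangle rotation group\<close>

lemma eventually_quadratic_neg:
  fixes a b c :: real
  assumes "a < 0"
  shows "\<forall>\<^sub>F \<epsilon> in at_right 0. a + \<epsilon> * b + \<epsilon> * \<epsilon> * c < 0"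
proof -
  have "((\<lambda>\<epsilon>. a + \<epsilon> * b + \<epsilon> * \<epsilon> * c) \<longlongrightarrow> a) (at_right 0)"
    by (auto intro!: tendsto_eq_intros)
  from order_tendstoD(2)[OF this assms] show ?thesis .
qed

lemma scaled_equations_solution:
  fixes a b :: real
  assumes "0 \<le> a" "a < 1" "0 \<le> b" "b < 1"
  obtains y z where "0 < y" "0 < z" "y\<^sup>2 = 1 + 2 * a * z" "z\<^sup>2 = 1 + 2 * b * y"
proof -
  define f where "f y = y\<^sup>2 - 1 - 2 * a * sqrt (1 + 2 * b * y)" for y
  have "f 0 \<le> 0" using assms by (simp add: f_def)
  \<comment> \<open>The end 3 works because \<open>sqrt (1 + 6 * b) \<le> 4\<close>, so
    \<open>f 3 \<ge> 8 - 2 * 4\<close>.\<close>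
  moreover have "0 \<le> f 3"
  proof -
    have "sqrt (1 + 2 * b * 3) \<le> sqrt 16" using assms by (intro real_sqrt_le_mono) simp
    moreover have "a * sqrt (1 + 2 * b * 3) \<le> 1 * sqrt (1 + 2 * b * 3)"
      using assms by (intro mult_right_mono) auto
    ultimately show ?thesis using real_sqrt_four by (simp add: f_def)
  qed
  moreover have "continuous_on {0..3} f"
    unfolding f_def by (intro continuous_intros)
  ultimately obtain y where y: "0 \<le> y" "y \<le> 3" "f y = 0"
    using IVT'[of f 0 0 3] by auto
  define z where "z = sqrt (1 + 2 * b * y)"
  have zz: "1 + 2 * b * y \<ge> 1" using assms y by simp
  then have z: "z > 0" "z\<^sup>2 = 1 + 2 * b * y" by (simp_all add: z_def)
  have yy: "y\<^sup>2 = 1 + 2 * a * z" using y(3) by (simp add: f_def z_def)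
  then have "y\<^sup>2 > 0" using assms z by (simp add: add_pos_nonneg)
  then have "y > 0" using y by (cases "y = 0") auto
  with that z yy show ?thesis by blast
qed

text \<open>Eliminating the differences gives \<open>(y + y') (z + z') = 4 a b < 4\<close>, although all four
  numbers are at least \<open>1\<close>.\<close>

lemma scaled_equations_unique:
  fixes a b :: real
  assumes ab: "0 \<le> a" "a < 1" "0 \<le> b" "b < 1"
    and pos: "0 < y" "0 < z" "0 < y'" "0 < z'"
    and 1: "y\<^sup>2 = 1 + 2 * a * z" "z\<^sup>2 = 1 + 2 * b * y"
    and 2: "y'\<^sup>2 = 1 + 2 * a * z'" "z'\<^sup>2 = 1 + 2 * b * y'"
  shows "y = y' \<and> z = z'"
proof -
  have ge: "1 \<le> x" if "0 < x" "x\<^sup>2 = 1 + 2 * c * u" "0 \<le> c" "0 < u" for x c u :: real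
    using that by (intro power2_le_imp_le[of 1 x]) auto
  have g: "1 \<le> y" "1 \<le> z" "1 \<le> y'" "1 \<le> z'"
    using ge[of y a z] ge[of z b y] ge[of y' a z'] ge[of z' b y'] assms by auto
  have e1: "(y - y') * (y + y') = 2 * a * (z - z')"
    using 1 2 by (simp add: power2_eq_square algebra_simps)
  have e2: "(z - z') * (z + z') = 2 * b * (y - y')"
    using 1 2 by (simp add: power2_eq_square algebra_simps)
  have "(y - y') * ((y + y') * (z + z') - 4 * (a * b)) = 0"
    using arg_cong[OF e1, of "\<lambda>u. u * (z + z')"] arg_cong[OF e2, of "\<lambda>u. 2 * a * u"]
    by (simp add: algebra_simps)
  moreover have "2 * 2 \<le> (y + y') * (z + z')" using g by (intro mult_mono) auto
  moreover have "a * b < 1" using mult_strict_mono'[of a 1 b 1] ab by simp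
  ultimately have y: "y = y'" by auto
  with 1 2 have "z\<^sup>2 = z'\<^sup>2" by simp
  with y pos show ?thesis by (simp add: power2_eq_iff)
qed

text \<open>Wall \<open>i\<close> lies opposite vertex \<open>i\<close>. Divided by
  \<open>lorentz (V i) (\<alpha> i)\<close>, the vertices form the basis dual to the roots, which is
  what \<open>vertex_expand\<close> records.\<close>

locale hyperbolic_triangle = reflection_roots \<alpha> m
  for \<alpha> :: "3 \<Rightarrow> real ^ 3" and m +
  fixes V :: "3 \<Rightarrow> real ^ 3"
  assumes vertex_H2: "V i \<in> H2"
    and vertex_orthogonal: "i \<noteq> j \<Longrightarrow> lorentz (V i) (\<alpha> j) = 0"
    and vertex_opposite: "0 < lorentz (V i) (\<alpha> i)"
    and vertex_expand: "X = (\<Sum>i\<in>UNIV. (lorentz X (\<alpha> i) / lorentz (V i) (\<alpha> i)) *\<^sub>R V i)"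
begin

definition chamber :: "(real ^ 3) set" where
  "chamber = {X \<in> H2. \<forall>i. 0 < lorentz X (\<alpha> i)}"

definition cell :: "real ^ 3 \<Rightarrow> (real ^ 3) set" where
  "cell K = {X \<in> H2. \<forall>w. even (length w) \<longrightarrow> lorentz X (refls w K) \<le> lorentz X K}"

lemma chamberD: "K \<in> chamber \<Longrightarrow> K \<in> H2" "K \<in> chamber \<Longrightarrow> 0 < lorentz K (\<alpha> i)"
  by (auto simp: chamber_def)

text \<open>A positive combination of vertices is timelike since points of \<open>H2\<close> have
  negative products. Normalising it scales all coordinates by the common factor
  \<open>t\<close>.\<close>

lemma exists_chamber_point:
  assumes c: "\<And>i. 0 < c i"
  obtains K t where "K \<in> chamber" "0 < t" "\<And>i. lorentz K (\<alpha> i) = t * c i"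
proof -
  define a where "a i = c i / lorentz (V i) (\<alpha> i)" for i
  define X where "X = a 1 *\<^sub>R V 1 + a 2 *\<^sub>R V 2 + a 3 *\<^sub>R V 3"
  have a: "0 < a i" for i using c vertex_opposite by (simp add: a_def)
  have neg: "a i * lorentz (V i) Y < 0" if "Y \<in> H2" for i Y
    using a[of i] lorentz_le_minus_one[OF vertex_H2 that, of i] by (intro mult_pos_neg) auto
  have XY: "lorentz X Y < 0" if "Y \<in> H2" for Y
    using neg[OF that, of 1] neg[OF that, of 2] neg[OF that, of 3]
    by (simp add: X_def lorentz_linear)
  have "a i * lorentz (V i) X < 0" for i
    using XY[OF vertex_H2[of i]] a[of i] by (simp add: lorentz_commute mult_pos_neg)
  from this[of 1] this[of 2] this[of 3] have XX: "lorentz X X < 0"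
    unfolding X_def lorentz_linear(1,5) by (simp flip: X_def)
  have Xa: "lorentz X (\<alpha> i) = c i" for i
    using exhaust_3[of i] vertex_opposite[of i]
    by (auto simp: X_def lorentz_linear vertex_orthogonal a_def)
  define t where "t = 1 / sqrt (- lorentz X X)"
  have "t > 0" using XX by (simp add: t_def)
  moreover have "t *\<^sub>R X \<in> H2"
    using H2_normalize[OF vertex_H2 XX XY[OF vertex_H2]] by (simp add: t_def)
  ultimately show ?thesis
    using that[of "t *\<^sub>R X" t] c Xa by (simp add: chamber_def lorentz_linear)
qed

lemma chamber_point_unique:
  assumes K: "K \<in> H2" and L: "L \<in> H2" and t: "0 < t"
    and eq: "\<And>i. lorentz K (\<alpha> i) = t * lorentz L (\<alpha> i)"
  shows "K = L"
proof -
  have "K = t *\<^sub>R L"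
    using vertex_expand[of K] vertex_expand[of "t *\<^sub>R L"] by (simp add: eq lorentz_linear)
  with K L have "t * t = 1" by (auto simp: H2_def lorentz_linear)
  then have "(t - 1) * (t + 1) = 0" by (simp add: algebra_simps)
  with t have "t = 1" by simp
  with \<open>K = t *\<^sub>R L\<close> show ?thesis by simp
qed

text \<open>The bracket is symmetric in \<open>i\<close> and \<open>j\<close> because the words
  \<open>[i, j]\<close> and \<open>[j, i]\<close> are inverse to each other.\<close>

lemma displacement:
  assumes "K \<in> H2"
  shows "lorentz K (refls [i, j] K) =
    - 1 - 2 * ((lorentz K (\<alpha> i))\<^sup>2 + (lorentz K (\<alpha> j))\<^sup>2
      - 2 * lorentz (\<alpha> i) (\<alpha> j) * lorentz K (\<alpha> i) * lorentz K (\<alpha> j))"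
proof -
  define x y g where "x = lorentz K (\<alpha> i)" and "y = lorentz K (\<alpha> j)" and "g = lorentz (\<alpha> i) (\<alpha> j)"
  have "lorentz (\<alpha> i) K = x" "lorentz (\<alpha> j) K = y" "lorentz K K = - 1"
    using assms by (simp_all add: x_def y_def lorentz_commute H2_def)
  then have "lorentz K (refls [i, j] K) = - 1 - 2 * (x\<^sup>2 + y\<^sup>2 - 2 * g * x * y)"
    by (simp add: hrefl_def lorentz_linear power2_eq_square algebra_simps flip: x_def y_def g_def)
  then show ?thesis unfolding x_def y_def g_def .
qed

lemma angle_bounds:
  assumes "i \<noteq> j"
  shows "0 < pi / real (m i j)" "pi / real (m i j) \<le> pi / 2"
proof -
  have "2 \<le> m i j" by (rule order_ge_2[OF assms])
  then have "2 \<le> real (m i j)" by simp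
  then show "0 < pi / real (m i j)" "pi / real (m i j) \<le> pi / 2"
    by (simp_all add: field_simps)
qed

lemma root_obtuse: "i \<noteq> j \<Longrightarrow> lorentz (\<alpha> i) (\<alpha> j) \<le> 0"
  using angle_bounds[of i j] cos_ge_zero[of "pi / real (m i j)"] by (simp add: root_angle)

lemma displacement_less:
  assumes K: "K \<in> chamber" and "i \<noteq> j"
  shows "lorentz K (refls [i, j] K) < - 1"
proof -
  have "(lorentz K (\<alpha> i))\<^sup>2 > 0" using chamberD(2)[OF K, of i] by (rule zero_less_power)
  moreover have "lorentz (\<alpha> i) (\<alpha> j) * (lorentz K (\<alpha> i) * lorentz K (\<alpha> j)) \<le> 0"
    using root_obtuse[OF assms(2)] chamberD(2)[OF K, of i] chamberD(2)[OF K, of j]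
    by (intro mult_nonpos_nonneg) auto
  moreover have "0 \<le> (lorentz K (\<alpha> j))\<^sup>2" by simp
  ultimately have "0 < (lorentz K (\<alpha> i))\<^sup>2 + (lorentz K (\<alpha> j))\<^sup>2 -
      2 * (lorentz (\<alpha> i) (\<alpha> j) * (lorentz K (\<alpha> i) * lorentz K (\<alpha> j)))"
    by linarith
  moreover have "- 1 - 2 * e < - 1" if "0 < e" for e :: real using that by simp
  ultimately show ?thesis unfolding displacement[OF chamberD(1)[OF K]] mult.assoc by blast
qed

lemma image_neq: "K \<in> chamber \<Longrightarrow> i \<noteq> j \<Longrightarrow> refls [i, j] K \<noteq> K"
  using displacement_less[of K i j] by (force simp: chamber_def H2_def)

section \<open>The sides of the cell and the tangent circle\<close>

lemma cellI:
  assumes "K \<in> chamber" "X \<in> H2"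
    and "\<And>i j. i \<noteq> j \<Longrightarrow> lorentz X (refls [i, j] K) \<le> lorentz X K"
  shows "X \<in> cell K"
proof -
  have "lorentz X (refls w K) \<le> lorentz X K" if "even (length w)" for w
    by (rule even_orbit_le[OF chamberD(2)[OF assms(1)] assms(3) that])
  with assms(2) show ?thesis by (simp add: cell_def)
qed

text \<open>The bisector of \<open>K\<close> and its image under \<open>s\<^sub>i s\<^sub>j\<close> contains the vertex common to the
  walls \<open>i\<close>, \<open>j\<close> and the mirror image in wall \<open>i\<close> of the point \<open>I\<close> of the triangle whose
  coordinates are reciprocal to those of \<open>K\<close>; so it carries a side of the cell.\<close>

lemma bisector_is_side:
  assumes K: "K \<in> chamber" and ij: "i \<noteq> j"
  shows "is_side (cell K) {X \<in> cell K. lorentz (refls [i, j] K - K) X = 0}"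
proof -
  let ?n = "refls [i, j] K - K"
  have KH: "K \<in> H2" and KH': "refls [i, j] K \<in> H2"
    using chamberD(1)[OF K] refls_H2[of K "[i, j]"] by auto
  have n: "lorentz ?n ?n > 0"
    using diff_H2_spacelike[OF KH KH'] image_neq[OF K ij] by auto
  have le: "lorentz ?n X \<le> 0" if "X \<in> cell K" for X
  proof -
    have "lorentz X (refls [i, j] K) \<le> lorentz X K"
      using that by (auto simp: cell_def dest!: spec[of _ "[i, j]"])
    then show ?thesis unfolding lorentz_commute[of _ X] lorentz_linear(4) by simp
  qed
  have "card {i, j} < card (UNIV :: 3 set)" using ij by simp
  then obtain l where "l \<notin> {i, j}" by (metis UNIV_eq_I less_irrefl)
  then have l: "l \<noteq> i" "l \<noteq> j" by auto
  have Vpos: "0 \<le> lorentz (V l) (\<alpha> k)" for k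
    using vertex_opposite[of l] vertex_orthogonal[of l k] by (cases "k = l") auto
  have Vcell: "V l \<in> cell K"
    using orbit_le(1)[OF Vpos, of K] chamberD(2)[OF K] vertex_H2 by (simp add: cell_def less_imp_le)
  have "lorentz (V l) (refls [i, j] K) = lorentz (refls [j, i] (V l)) K"
    by (simp add: lorentz_hrefl_adjoint)
  also have "refls [j, i] (V l) = V l"
    using l vertex_orthogonal by (intro refls_orthogonal) (auto simp: lorentz_commute[of "\<alpha> _"])
  finally have V0: "lorentz ?n (V l) = 0" by (simp only: lorentz_linear lorentz_commute[of _ "V l"])
  \<comment> \<open>Reciprocal coordinates make \<open>I\<close> equidistant from the three
    reflected copies of \<open>K\<close>: each product is
    \<open>lorentz I K - 2 * t\<close>.\<close>
  obtain I t where I: "I \<in> chamber" "0 < t" "\<And>k. lorentz I (\<alpha> k) = t * (1 / lorentz K (\<alpha> k))"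
    using exists_chamber_point[of "\<lambda>k. 1 / lorentz K (\<alpha> k)"] chamberD(2)[OF K] by (metis zero_less_divide_1_iff)
  have Ieq: "lorentz I (hrefl (\<alpha> k) K) = lorentz I K - 2 * t" for k
    using chamberD(2)[OF K, of k] I(3)[of k]
    by (simp add: hrefl_def lorentz_linear lorentz_commute[of "\<alpha> k" K])
  have IH: "hrefl (\<alpha> i) I \<in> H2" using I chamberD(1) hrefl_H2 by simp
  have "lorentz (hrefl (\<alpha> i) I) (refls w K) \<le> lorentz (hrefl (\<alpha> i) I) K" if w: "even (length w)" for w
  proof -
    obtain k where "lorentz I (refls (i # w) K) \<le> lorentz I (hrefl (\<alpha> k) K)"
      using orbit_le(2)[of I K "i # w"] chamberD(2)[OF K] chamberD(2)[OF I(1)] w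
      by (auto simp: less_imp_le)
    also have "\<dots> = lorentz I (hrefl (\<alpha> i) K)" using Ieq by simp
    finally show ?thesis by (simp add: lorentz_hrefl_adjoint)
  qed
  then have Icell: "hrefl (\<alpha> i) I \<in> cell K" using IH by (simp add: cell_def)
  have I0: "lorentz ?n (hrefl (\<alpha> i) I) = 0"
    unfolding lorentz_linear lorentz_commute[of _ "hrefl (\<alpha> i) I"]
    by (simp add: lorentz_hrefl_adjoint hrefl_hrefl Ieq)
  \<comment> \<open>The vertex lies on wall \<open>i\<close>, the reflected point strictly beyond
    it.\<close>
  have "hrefl (\<alpha> i) I \<noteq> V l"
  proof
    assume "hrefl (\<alpha> i) I = V l"
    then have "lorentz (V l) (\<alpha> i) = lorentz I (hrefl (\<alpha> i) (\<alpha> i))"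
      by (simp flip: lorentz_hrefl_adjoint)
    then show False
      using vertex_orthogonal[OF l(1)] chamberD(2)[OF I(1), of i] by (simp add: hrefl_self lorentz_linear)
  qed
  then show ?thesis
    using n le Vcell V0 Icell I0 unfolding is_side_def by blast
qed

lemma circumscribed_imp_equal_displacement:
  assumes K: "K \<in> chamber" and circ: "circumscribed_about_circle_at (cell K) K"
  shows "\<exists>c. \<forall>i j. i \<noteq> j \<longrightarrow> lorentz K (refls [i, j] K) = c"
proof -
  obtain r where r: "r > 0" "\<And>S. is_side (cell K) S \<Longrightarrow> circle_tangent_to_side K r S"
    using circ by (auto simp: circumscribed_about_circle_at_def)
  have "lorentz K (refls [i, j] K) = 1 - 2 * (cosh r)\<^sup>2" if ij: "i \<noteq> j" for i j
  proof -
    let ?Q = "refls [i, j] K"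
    let ?S = "{X \<in> cell K. lorentz (?Q - K) X = 0}"
    have KH: "K \<in> H2" "?Q \<in> H2" using chamberD(1)[OF K] refls_H2[of K "[i, j]"] by auto
    have side: "is_side (cell K) ?S" by (rule bisector_is_side[OF K ij])
    then obtain X Y where XY: "X \<in> ?S" "Y \<in> ?S" "X \<noteq> Y" unfolding is_side_def by blast
    obtain L where L: "hline L" "?S \<subseteq> L" "\<exists>X\<in>?S. hcircle K r \<inter> L = {X}"
      using r(2)[OF side] unfolding circle_tangent_to_side_def by blast
    have sub: "?S \<subseteq> hbisector K ?Q" by (auto simp: hbisector_def cell_def)
    \<comment> \<open>Tangency speaks of some line containing the side; two points of the side leave
      no choice.\<close>
    have "L = hbisector K ?Q"
      by (rule hline_unique[OF L(1) hline_hbisector[OF KH image_neq[OF K ij, symmetric]] XY(3)])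
        (use XY(1,2) L(2) sub in blast)+
    then show ?thesis using L(3) tangent_bisector_radius[OF KH r(1)] by auto
  qed
  then show ?thesis by blast
qed

text \<open>If every neighbour inequality were strict at the middle of \<open>XY\<close>, a small
  push along \<open>n\<close> would stay in the cell yet leave the half-plane
  \<open>lorentz n U \<le> 0\<close>.\<close>

lemma side_on_bisector:
  assumes K: "K \<in> chamber" and "is_side (cell K) S"
  shows "\<exists>i j. i \<noteq> j \<and> S = cell K \<inter> hbisector K (refls [i, j] K)"
proof -
  obtain n X Y where n: "lorentz n n > 0" "\<And>X. X \<in> cell K \<Longrightarrow> lorentz n X \<le> 0"
    and S: "S = {X \<in> cell K. lorentz n X = 0}" and XY: "X \<in> S" "Y \<in> S" "X \<noteq> Y"
    using assms(2) unfolding is_side_def by blast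
  have KH: "K \<in> H2" using chamberD(1)[OF K] .
  have X: "X \<in> H2" "X \<in> cell K" "lorentz n X = 0" and Y: "Y \<in> H2" "Y \<in> cell K" "lorentz n Y = 0"
    using XY S by (auto simp: cell_def)
  define Z where "Z = X + Y"
  have ZZ: "lorentz Z Z < 0"
    using X(1) Y(1) lorentz_le_minus_one[OF X(1) Y(1)]
    by (simp add: Z_def lorentz_linear H2_def lorentz_commute)
  have ZK: "lorentz Z K < 0"
    using lorentz_le_minus_one[OF X(1) KH] lorentz_le_minus_one[OF Y(1) KH]
    by (simp add: Z_def lorentz_linear)
  have "\<exists>i j. i \<noteq> j \<and> lorentz Z (refls [i, j] K - K) \<ge> 0"
  proof (rule ccontr)
    assume "\<not> ?thesis"
    then have neg: "lorentz Z (refls [i, j] K - K) < 0" if "i \<noteq> j" for i j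
      using that by (meson not_le)
    have lin: "lorentz (Z + \<epsilon> *\<^sub>R n) U = lorentz Z U + \<epsilon> * lorentz n U + \<epsilon> * \<epsilon> * 0" for \<epsilon> U
      by (simp add: lorentz_linear)
    have "\<forall>\<^sub>F \<epsilon> in at_right 0. lorentz (Z + \<epsilon> *\<^sub>R n) (refls [i, j] K - K) < 0" if "i \<noteq> j" for i j
      unfolding lin using eventually_quadratic_neg[OF neg[OF that]] .
    then have "\<forall>\<^sub>F \<epsilon> in at_right 0. \<forall>i. \<forall>j. i \<noteq> j \<longrightarrow> lorentz (Z + \<epsilon> *\<^sub>R n) (refls [i, j] K - K) < 0"
      by (intro eventually_all_finite) (simp del: refls.simps)
    moreover have "\<forall>\<^sub>F \<epsilon> in at_right 0. lorentz (Z + \<epsilon> *\<^sub>R n) K < 0"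
      unfolding lin using eventually_quadratic_neg[OF ZK] .
    moreover have "\<forall>\<^sub>F \<epsilon> in at_right 0. lorentz (Z + \<epsilon> *\<^sub>R n) (Z + \<epsilon> *\<^sub>R n) < 0"
    proof -
      have "lorentz (Z + \<epsilon> *\<^sub>R n) (Z + \<epsilon> *\<^sub>R n) =
          lorentz Z Z + \<epsilon> * (2 * lorentz n Z) + \<epsilon> * \<epsilon> * lorentz n n" for \<epsilon>
        by (simp add: lorentz_linear lorentz_commute[of Z n] algebra_simps)
      then show ?thesis using eventually_quadratic_neg[OF ZZ] by presburger
    qed
    moreover have "\<forall>\<^sub>F \<epsilon> in at_right 0. (0 :: real) < \<epsilon>" by (rule eventually_at_right_less)
    ultimately have "\<forall>\<^sub>F \<epsilon> in at_right 0. 0 < \<epsilon> \<and> lorentz (Z + \<epsilon> *\<^sub>R n) (Z + \<epsilon> *\<^sub>R n) < 0 \<and>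
        lorentz (Z + \<epsilon> *\<^sub>R n) K < 0 \<and>
        (\<forall>i j. i \<noteq> j \<longrightarrow> lorentz (Z + \<epsilon> *\<^sub>R n) (refls [i, j] K - K) < 0)"
      by eventually_elim blast
    from eventually_happens'[OF trivial_limit_at_right_real this]
    obtain \<epsilon> where "0 < \<epsilon> \<and> lorentz (Z + \<epsilon> *\<^sub>R n) (Z + \<epsilon> *\<^sub>R n) < 0 \<and>
        lorentz (Z + \<epsilon> *\<^sub>R n) K < 0 \<and>
        (\<forall>i j. i \<noteq> j \<longrightarrow> lorentz (Z + \<epsilon> *\<^sub>R n) (refls [i, j] K - K) < 0)" ..
    then have \<epsilon>: "0 < \<epsilon>" "lorentz (Z + \<epsilon> *\<^sub>R n) (Z + \<epsilon> *\<^sub>R n) < 0"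
        "lorentz (Z + \<epsilon> *\<^sub>R n) K < 0"
        "\<And>i j. i \<noteq> j \<Longrightarrow> lorentz (Z + \<epsilon> *\<^sub>R n) (refls [i, j] K - K) < 0"
      by blast+
    define t where "t = 1 / sqrt (- lorentz (Z + \<epsilon> *\<^sub>R n) (Z + \<epsilon> *\<^sub>R n))"
    define W where "W = t *\<^sub>R (Z + \<epsilon> *\<^sub>R n)"
    have t: "t > 0" using \<epsilon>(2) by (simp add: t_def)
    have "W \<in> H2" using H2_normalize[OF KH \<epsilon>(2,3)] by (simp add: W_def t_def)
    moreover have "lorentz W (refls [i, j] K) \<le> lorentz W K" if "i \<noteq> j" for i j
    proof -
      have "t * lorentz (Z + \<epsilon> *\<^sub>R n) (refls [i, j] K - K) < 0"
        using t \<epsilon>(4)[OF that] by (simp only: mult_pos_neg)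
      then show ?thesis unfolding W_def lorentz_linear(5) lorentz_linear(4) by (simp only: right_diff_distrib)
    qed
    ultimately have "W \<in> cell K" using cellI[OF K] by blast
    then have "lorentz n W \<le> 0" by (rule n(2))
    moreover have "lorentz n W = t * (\<epsilon> * lorentz n n)"
      using X Y by (simp add: W_def Z_def lorentz_linear)
    ultimately show False using t \<epsilon>(1) n(1) by (simp add: mult_le_0_iff)
  qed
  then obtain i j where ij: "i \<noteq> j" and Zij: "lorentz Z (refls [i, j] K - K) \<ge> 0" by blast
  let ?Q = "refls [i, j] K"
  have QH: "?Q \<in> H2" using refls_H2[OF KH] .
  have le: "lorentz U (?Q - K) \<le> 0" if "U \<in> cell K" for U
    using that by (auto simp: cell_def lorentz_linear(4) dest!: spec[of _ "[i, j]"])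
  have "lorentz X (?Q - K) + lorentz Y (?Q - K) \<ge> 0" using Zij by (simp only: Z_def lorentz_linear(1))
  \<comment> \<open>Two nonpositive numbers with nonnegative sum vanish, so the inequality that is
    tight in the middle is tight at both ends.\<close>
  with le[OF X(2)] le[OF Y(2)] have "lorentz X (?Q - K) = 0" "lorentz Y (?Q - K) = 0" by linarith+
  then have "X \<in> hbisector K ?Q" "Y \<in> hbisector K ?Q"
    using X(1) Y(1) by (simp_all only: hbisector_def mem_Collect_eq lorentz_commute[of "?Q - K"])
  moreover have "hline {U \<in> H2. lorentz n U = 0}" using n(1) by (auto simp: hline_def)
  ultimately have "hbisector K ?Q = {U \<in> H2. lorentz n U = 0}"
    using X Y by (intro hline_unique[OF hline_hbisector[OF KH QH image_neq[OF K ij, symmetric]] _ XY(3)]) simp_all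
  moreover have "S = cell K \<inter> {U \<in> H2. lorentz n U = 0}" using S by (auto simp: cell_def)
  ultimately show ?thesis using ij by auto
qed

text \<open>For equal displacements the midpoint of \<open>K\<close> and any neighbour \<open>Q\<close> lies in the cell, because
  \<open>\<langle>K + Q, K - Q'\<rangle> = -1 - \<langle>Q, Q'\<rangle> \<ge> 0\<close> for every other neighbour \<open>Q'\<close>.\<close>

lemma equal_displacement_imp_circumscribed:
  assumes K: "K \<in> chamber" and eq: "\<And>i j. i \<noteq> j \<Longrightarrow> lorentz K (refls [i, j] K) = c"
  shows "circumscribed_about_circle_at (cell K) K"
proof -
  have KH: "K \<in> H2" using chamberD(1)[OF K] .
  have c: "c < - 1" using displacement_less[OF K, of 1 2] eq[of 1 2] by simp
  \<comment> \<open>Half the displacement: \<open>cosh\<^sup>2 r = (1 + cosh (2 r)) / 2\<close> with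
    \<open>cosh (2 r) = - c\<close>.\<close>
  define r where "r = arcosh (sqrt ((1 - c) / 2))"
  have s: "sqrt ((1 - c) / 2) > 1" using c by simp
  then have r: "r > 0" by (simp add: r_def)
  have rc: "1 - 2 * (cosh r)\<^sup>2 = c" using s c by (simp add: r_def field_simps)
  have "circle_tangent_to_side K r S" if side: "is_side (cell K) S" for S
  proof -
    obtain i j where ij: "i \<noteq> j" and S: "S = cell K \<inter> hbisector K (refls [i, j] K)"
      using side_on_bisector[OF K side] by blast
    let ?Q = "refls [i, j] K"
    have QH: "?Q \<in> H2" using refls_H2[OF KH] .
    have KQ: "lorentz K ?Q = c" by (rule eq[OF ij])
    then have rK: "lorentz K ?Q = 1 - 2 * (cosh r)\<^sup>2" unfolding rc .
    obtain M t where M: "hcircle K r \<inter> hbisector K ?Q = {M}" "M \<in> H2" and t: "t > 0" "M = t *\<^sub>R (K + ?Q)"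
      using tangent_bisector[OF KH QH r rK] by blast
    have "M \<in> cell K"
    proof (rule cellI[OF K M(2)])
      fix k l :: 3 assume kl: "k \<noteq> l"
      let ?R = "refls [k, l] K"
      have "lorentz (K + ?Q) ?R \<le> c - 1"
        using eq[OF kl] lorentz_le_minus_one[OF QH refls_H2[OF KH, of "[k, l]"]]
        unfolding lorentz_linear(1) by linarith
      moreover have "lorentz (K + ?Q) K = c - 1"
        unfolding lorentz_linear(1) lorentz_commute[of ?Q K] KQ using KH by (simp add: H2_def)
      ultimately show "lorentz M ?R \<le> lorentz M K"
        unfolding t(2) lorentz_linear(5) using t(1) by (intro mult_left_mono) linarith+
    qed
    then have "M \<in> S" using M(1) S by auto
    then show ?thesis
      unfolding circle_tangent_to_side_def
      using M(1) S hline_hbisector[OF KH QH image_neq[OF K ij, symmetric]] by blast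
  qed
  then show ?thesis using r unfolding circumscribed_about_circle_at_def by blast
qed

text \<open>Comparing the pairs \<open>(1, 3)\<close> and \<open>(1, 2)\<close> with the
  right-angled pair \<open>(2, 3)\<close> cancels one square each time. The resulting equations are
  homogeneous, so the first coordinate can be scaled to 1.\<close>

lemma unique_circumscribed_cell:
  assumes right: "m 2 3 = 2"
  shows "\<exists>!K. K \<in> chamber \<and> circumscribed_about_circle_at (cell K) K"
proof -
  define a where "a = cos (pi / real (m 1 3))"
  define b where "b = cos (pi / real (m 1 2))"
  have cs: "0 \<le> cos (pi / real (m i j)) \<and> cos (pi / real (m i j)) < 1" if "i \<noteq> j" for i j
  proof -
    have "0 < pi / real (m i j)" "pi / real (m i j) \<le> pi / 2" using angle_bounds[OF that] .
    moreover from this have "pi / real (m i j) \<le> pi" using pi_gt_zero by linarith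
    ultimately show ?thesis
      using cos_monotone_0_pi[of 0 "pi / real (m i j)"] cos_ge_zero[of "pi / real (m i j)"] by simp
  qed
  have ab: "0 \<le> a" "a < 1" "0 \<le> b" "b < 1" using cs[of 1 3] cs[of 1 2] by (simp_all add: a_def b_def)
  have roots: "lorentz (\<alpha> 2) (\<alpha> 3) = 0" "lorentz (\<alpha> 1) (\<alpha> 3) = - a" "lorentz (\<alpha> 1) (\<alpha> 2) = - b"
    using root_angle[of 2 3] root_angle[of 1 3] root_angle[of 1 2] by (simp_all add: right a_def b_def)
  have equal_iff: "(\<exists>c. \<forall>i j. i \<noteq> j \<longrightarrow> lorentz K (refls [i, j] K) = c) \<longleftrightarrow>
      (lorentz K (\<alpha> 2))\<^sup>2 = (lorentz K (\<alpha> 1))\<^sup>2 + 2 * a * lorentz K (\<alpha> 1) * lorentz K (\<alpha> 3) \<and>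
      (lorentz K (\<alpha> 3))\<^sup>2 = (lorentz K (\<alpha> 1))\<^sup>2 + 2 * b * lorentz K (\<alpha> 1) * lorentz K (\<alpha> 2)"
    (is "?eq \<longleftrightarrow> ?coord") if "K \<in> H2" for K
  proof
    assume ?eq
    then obtain c where "\<And>i j. i \<noteq> j \<Longrightarrow> lorentz K (refls [i, j] K) = c" by blast
    from this[of 2 3] this[of 1 3] this[of 1 2]
    have "lorentz K (refls [2, 3] K) = lorentz K (refls [1, 3] K)"
      "lorentz K (refls [2, 3] K) = lorentz K (refls [1, 2] K)" by simp_all
    then show ?coord unfolding displacement[OF that] roots by (simp add: algebra_simps)
  next
    assume coord: ?coord
    have "lorentz K (refls [i, j] K) = lorentz K (refls [2, 3] K)" if "i \<noteq> j" for i j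
      using exhaust_3[of i] exhaust_3[of j] that roots coord
      unfolding displacement[OF \<open>K \<in> H2\<close>]
      by (elim disjE) (simp_all add: lorentz_commute[of "\<alpha> 3"] lorentz_commute[of "\<alpha> 2" "\<alpha> 1"])
    then show ?eq by blast
  qed
  have circ_iff: "circumscribed_about_circle_at (cell K) K \<longleftrightarrow>
      (lorentz K (\<alpha> 2))\<^sup>2 = (lorentz K (\<alpha> 1))\<^sup>2 + 2 * a * lorentz K (\<alpha> 1) * lorentz K (\<alpha> 3) \<and>
      (lorentz K (\<alpha> 3))\<^sup>2 = (lorentz K (\<alpha> 1))\<^sup>2 + 2 * b * lorentz K (\<alpha> 1) * lorentz K (\<alpha> 2)"
    if K: "K \<in> chamber" for K
    unfolding equal_iff[OF chamberD(1)[OF K], symmetric]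
  proof
    assume "circumscribed_about_circle_at (cell K) K"
    then show "\<exists>c. \<forall>i j. i \<noteq> j \<longrightarrow> lorentz K (refls [i, j] K) = c"
      by (rule circumscribed_imp_equal_displacement[OF K])
  next
    assume "\<exists>c. \<forall>i j. i \<noteq> j \<longrightarrow> lorentz K (refls [i, j] K) = c"
    then obtain c where "\<And>i j. i \<noteq> j \<Longrightarrow> lorentz K (refls [i, j] K) = c" by blast
    then show "circumscribed_about_circle_at (cell K) K"
      by (rule equal_displacement_imp_circumscribed[OF K])
  qed
  obtain y z where yz: "0 < y" "0 < z" "y\<^sup>2 = 1 + 2 * a * z" "z\<^sup>2 = 1 + 2 * b * y"
    using scaled_equations_solution[OF ab] by blast
  define v :: "3 \<Rightarrow> real" where "v i = (if i = 1 then 1 else if i = 2 then y else z)" for i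
  have v: "v 1 = 1" "v 2 = y" "v 3 = z" by (simp_all add: v_def)
  have "0 < v i" for i using yz by (simp add: v_def)
  then obtain K t where K: "K \<in> chamber" "0 < t" "\<And>i. lorentz K (\<alpha> i) = t * v i"
    using exists_chamber_point by blast
  show ?thesis
  proof (rule ex1I[of _ K])
    show "K \<in> chamber \<and> circumscribed_about_circle_at (cell K) K"
      unfolding circ_iff[OF K(1)] K(3) v using K(1) yz
      by (simp add: power_mult_distrib) (simp add: power2_eq_square algebra_simps)
    fix L assume L: "L \<in> chamber \<and> circumscribed_about_circle_at (cell L) L"
    define x where "x = lorentz L (\<alpha> 1)"
    define y' where "y' = lorentz L (\<alpha> 2) / x"
    define z' where "z' = lorentz L (\<alpha> 3) / x"
    have x: "0 < x" and pos: "0 < y'" "0 < z'" using L chamberD(2)[of L] by (simp_all add: x_def y'_def z'_def)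
    have Lc: "lorentz L (\<alpha> 1) = x" "lorentz L (\<alpha> 2) = x * y'" "lorentz L (\<alpha> 3) = x * z'"
      using x by (simp_all add: x_def y'_def z'_def)
    have "x\<^sup>2 * y'\<^sup>2 = x\<^sup>2 * (1 + 2 * a * z')" "x\<^sup>2 * z'\<^sup>2 = x\<^sup>2 * (1 + 2 * b * y')"
      using L circ_iff[of L] unfolding Lc by (simp_all add: power2_eq_square algebra_simps)
    then have "y'\<^sup>2 = 1 + 2 * a * z'" "z'\<^sup>2 = 1 + 2 * b * y'" using x by simp_all
    from scaled_equations_unique[OF ab yz(1,2) pos yz(3,4) this] have e: "y' = y" "z' = z" by simp_all
    have "lorentz L (\<alpha> i) = (x / t) * lorentz K (\<alpha> i)" for i
      using exhaust_3[of i] K(2) Lc e by (auto simp: K(3) v)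
    then show "L = K"
      using chamber_point_unique[of L K "x / t"] L K x chamberD(1) by simp
  qed
qed

end

section \<open>Rotations as products of two reflections\<close>

lemma tangent_frame_lorentz:
  assumes "P \<in> H2" "tangent_frame P e f"
  shows "lorentz P P = - 1" "lorentz P e = 0" "lorentz P f = 0" "lorentz e P = 0" "lorentz f P = 0"
    "lorentz e f = 0" "lorentz f e = 0" "lorentz e e = 1" "lorentz f f = 1"
  using assms by (auto simp: H2_def tangent_frame_def lorentz_commute)

text \<open>Cross products of frame vectors are again frame vectors up to sign, so
  \<open>lcross_expand_dual\<close> becomes an orthonormal expansion; \<open>D\<close> is 1 or -1 by
  orientation. The minus sign appears because \<open>P\<close> is timelike.\<close>

lemma frame_expand:
  assumes P: "P \<in> H2" and frame: "tangent_frame P e f"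
  shows "X = (- lorentz P X) *\<^sub>R P + lorentz e X *\<^sub>R e + lorentz f X *\<^sub>R f"
proof -
  note l = tangent_frame_lorentz[OF P frame]
  define D where "D = lorentz (lcross e f) P"
  note ex = lcross_expand_dual[of e f P, folded D_def]
  have P': "lcross e f = - (D *\<^sub>R P)" and e: "lcross f P = D *\<^sub>R e" and f: "lcross P e = D *\<^sub>R f"
    using ex[of P] ex[of e] ex[of f] by (simp_all add: l)
  have "D * D = 1"
    using lorentz_lcross_lcross[of e f e f] by (simp add: P' l lorentz_linear)
  then have "D \<noteq> 0" by auto
  have "D *\<^sub>R X = D *\<^sub>R ((- lorentz P X) *\<^sub>R P + lorentz e X *\<^sub>R e + lorentz f X *\<^sub>R f)"
    unfolding ex[of X] P' e f by (simp add: algebra_simps)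
  then show ?thesis by (rule scaleR_left_imp_eq[OF \<open>D \<noteq> 0\<close>])
qed

lemma exists_angle:
  fixes x y s :: real
  assumes "x\<^sup>2 + y\<^sup>2 = s\<^sup>2"
  shows "\<exists>\<phi>. x = s * cos \<phi> \<and> y = s * sin \<phi>"
proof (cases "s = 0")
  case True
  with assms show ?thesis by (simp add: sum_power2_eq_zero_iff)
next
  case False
  then have "(x / s)\<^sup>2 + (y / s)\<^sup>2 = 1"
    using assms by (simp add: power_divide flip: add_divide_distrib)
  then obtain \<phi> where "x / s = cos \<phi>" "y / s = sin \<phi>" by (rule sincos_total_2pi)
  with False show ?thesis by (intro exI[of _ \<phi>]) (simp add: field_simps)
qed

text \<open>\<open>is_hrotation\<close> prescribes values only at points in polar form; these
  exhaust \<open>H2\<close>.\<close>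

lemma exists_polar:
  assumes P: "P \<in> H2" and frame: "tangent_frame P e f" and X: "X \<in> H2"
  shows "\<exists>\<rho>\<ge>0. \<exists>\<phi>. X = hpolar P e f \<rho> \<phi>"
proof -
  define x y z where "x = - lorentz P X" and "y = lorentz e X" and "z = lorentz f X"
  note l = tangent_frame_lorentz[OF P frame]
  have x: "1 \<le> x" using lorentz_le_minus_one[OF P X] by (simp add: x_def)
  have Xe: "X = x *\<^sub>R P + y *\<^sub>R e + z *\<^sub>R f"
    using frame_expand[OF P frame, of X] by (simp add: x_def y_def z_def)
  have "lorentz X X = - x * x + y * y + z * z"
    by (subst (1 2) Xe) (simp add: lorentz_linear l)
  then have yz: "y\<^sup>2 + z\<^sup>2 = x\<^sup>2 - 1" using X by (simp add: H2_def power2_eq_square)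
  define \<rho> where "\<rho> = arcosh x"
  have "\<rho> \<ge> 0" "cosh \<rho> = x" "(sinh \<rho>)\<^sup>2 = x\<^sup>2 - 1"
    using x by (simp_all add: \<rho>_def sinh_square_eq)
  moreover obtain \<phi> where "y = sinh \<rho> * cos \<phi>" "z = sinh \<rho> * sin \<phi>"
    using exists_angle[of y z "sinh \<rho>"] yz \<open>(sinh \<rho>)\<^sup>2 = x\<^sup>2 - 1\<close> by auto
  ultimately show ?thesis
    by (intro exI[of _ \<rho>] conjI exI[of _ \<phi>]) (simp_all add: Xe hpolar_def scaleR_add_right add.assoc)
qed

text \<open>The mirror with normal direction \<open>a\<close> runs in direction
  \<open>a + pi / 2\<close>, and reflecting in it takes \<open>\<phi>\<close> to
  \<open>2 * (a + pi / 2) - \<phi>\<close>.\<close>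

lemma hrefl_hpolar:
  assumes P: "P \<in> H2" and frame: "tangent_frame P e f" and u: "u = cos a *\<^sub>R e + sin a *\<^sub>R f"
  shows "hrefl u (hpolar P e f \<rho> \<phi>) = hpolar P e f \<rho> (2 * a + pi - \<phi>)"
proof -
  note l = tangent_frame_lorentz[OF P frame]
  define b where "b = \<phi> - a"
  have \<phi>: "\<phi> = b + a" by (simp add: b_def)
  have "2 * a + pi - \<phi> = (a - b) + pi" by (simp add: \<phi>)
  then have c: "cos (2 * a + pi - \<phi>) = cos \<phi> - 2 * cos b * cos a"
    and s: "sin (2 * a + pi - \<phi>) = sin \<phi> - 2 * cos b * sin a"
    by (simp_all add: \<phi> cos_add sin_add cos_diff sin_diff)
  have lu: "lorentz u (hpolar P e f \<rho> \<phi>) = sinh \<rho> * cos b"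
    by (simp add: u hpolar_def lorentz_linear l b_def cos_diff algebra_simps)
  show ?thesis
    unfolding hrefl_def lu unfolding hpolar_def c s u by (simp add: algebra_simps)
qed

lemma unit_tangent_angle:
  assumes P: "P \<in> H2" and frame: "tangent_frame P e f"
    and u: "lorentz u u = 1" "lorentz P u = 0"
  shows "\<exists>a. u = cos a *\<^sub>R e + sin a *\<^sub>R f"
proof -
  note l = tangent_frame_lorentz[OF P frame]
  define y z where "y = lorentz e u" and "z = lorentz f u"
  have ue: "u = y *\<^sub>R e + z *\<^sub>R f"
    using frame_expand[OF P frame, of u] u by (simp add: y_def z_def)
  have "lorentz u u = y * y + z * z"
    by (subst (1 2) ue) (simp add: lorentz_linear l)
  then have "y\<^sup>2 + z\<^sup>2 = 1\<^sup>2" using u by (simp add: power2_eq_square)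
  from exists_angle[OF this] ue show ?thesis by auto
qed

text \<open>Reflections with normals at angles \<open>a\<close>, \<open>b\<close> compose to a
  rotation by \<open>2 * (a - b)\<close>. Only the cosine of this angle is determined, and the frame
  may have either orientation, so either order can occur. The sign in \<open>uv\<close> is that of
  inward normals at an interior angle \<open>\<theta> / 2\<close>.\<close>

lemma rotation_eq_reflections:
  assumes rot: "is_hrotation P \<theta> g"
    and u: "lorentz u u = 1" "lorentz P u = 0" and v: "lorentz v v = 1" "lorentz P v = 0"
    and uv: "lorentz u v = - cos (\<theta> / 2)"
  shows "(\<forall>X\<in>H2. g X = hrefl u (hrefl v X)) \<or> (\<forall>X\<in>H2. g X = hrefl v (hrefl u X))"
proof -
  have P: "P \<in> H2" using rot by (simp add: is_hrotation_def)
  obtain e f where frame: "tangent_frame P e f"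
    and g: "\<And>\<rho> \<phi>. \<rho> \<ge> 0 \<Longrightarrow> g (hpolar P e f \<rho> \<phi>) = hpolar P e f \<rho> (\<phi> + \<theta>)"
    using rot by (auto simp: is_hrotation_def)
  obtain a where a: "u = cos a *\<^sub>R e + sin a *\<^sub>R f" using unit_tangent_angle[OF P frame u] by blast
  obtain b where b: "v = cos b *\<^sub>R e + sin b *\<^sub>R f" using unit_tangent_angle[OF P frame v] by blast
  define \<delta> where "\<delta> = 2 * (a - b)"
  have comp: "hrefl u (hrefl v (hpolar P e f \<rho> \<phi>)) = hpolar P e f \<rho> (\<phi> + \<delta>)"
    "hrefl v (hrefl u (hpolar P e f \<rho> \<phi>)) = hpolar P e f \<rho> (\<phi> + - \<delta>)" for \<rho> \<phi>
    by (simp_all add: hrefl_hpolar[OF P frame a] hrefl_hpolar[OF P frame b] \<delta>_def algebra_simps)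
  have "lorentz u v = cos (a - b)"
    using frame by (simp add: a b lorentz_linear tangent_frame_def lorentz_commute[of f e] cos_diff)
  then have "cos (a - b) = - cos (\<theta> / 2)" using uv by simp
  then have "(cos (a - b))\<^sup>2 = (cos (\<theta> / 2))\<^sup>2" by simp
  then have cos: "cos \<delta> = cos \<theta>"
    using cos_double_cos[of "a - b"] cos_double_cos[of "\<theta> / 2"] by (simp add: \<delta>_def)
  then have "(sin \<delta>)\<^sup>2 = (sin \<theta>)\<^sup>2" by (simp add: sin_squared_eq)
  then consider "sin \<delta> = sin \<theta>" | "sin (- \<delta>) = sin \<theta>" by (auto simp: power2_eq_iff)
  then show ?thesis
  proof cases
    case 1
    then have "hpolar P e f \<rho> (\<phi> + \<delta>) = hpolar P e f \<rho> (\<phi> + \<theta>)" for \<rho> \<phi>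
      by (simp add: hpolar_def cos_add sin_add cos)
    then have "\<forall>X\<in>H2. g X = hrefl u (hrefl v X)"
      by (auto dest!: exists_polar[OF P frame] simp: g comp(1))
    then show ?thesis ..
  next
    case 2
    moreover have "cos (- \<delta>) = cos \<theta>" using cos by simp
    ultimately have "hpolar P e f \<rho> (\<phi> + - \<delta>) = hpolar P e f \<rho> (\<phi> + \<theta>)" for \<rho> \<phi>
      unfolding hpolar_def cos_add sin_add by simp
    then have "\<forall>X\<in>H2. g X = hrefl v (hrefl u X)"
      by (auto dest!: exists_polar[OF P frame] simp: g comp(2) simp del: add_uminus_conv_diff)
    then show ?thesis ..
  qed
qed

section \<open>The roots of a triangle\<close>

lemma hangle_commute: "hangle X P Y = hangle Y P X"
  by (simp add: hangle_def lorentz_commute mult.commute)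

text \<open>The tangent plane is positive definite. The inequality keeps the argument of
  \<open>arccos\<close> in \<open>hangle\<close> within \<open>[-1, 1]\<close>.\<close>

lemma lorentz_tangent_cauchy_schwarz:
  assumes P: "P \<in> H2" and u: "lorentz P u = 0" and v: "lorentz P v = 0"
  shows "(lorentz u v)\<^sup>2 \<le> lorentz u u * lorentz v v"
proof (cases "v = 0")
  case True
  then show ?thesis by (simp add: lorentz_linear)
next
  case False
  then have vv: "0 < lorentz v v" using lorentz_orthogonal_pos[OF P v] by simp
  define w where "w = lorentz v v *\<^sub>R u - lorentz u v *\<^sub>R v"
  have "lorentz P w = 0" using u v by (simp add: w_def lorentz_linear)
  then have "0 \<le> lorentz w w"
    using lorentz_orthogonal_pos[OF P, of w] by (cases "w = 0") (auto simp: lorentz_linear)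
  also have "lorentz w w = lorentz v v * (lorentz u u * lorentz v v - (lorentz u v)\<^sup>2)"
    by (simp add: w_def lorentz_linear lorentz_commute[of v u] power2_eq_square algebra_simps)
  finally show ?thesis using vv by (simp add: zero_le_mult_iff)
qed

definition wall :: "real \<Rightarrow> real ^ 3 \<Rightarrow> real ^ 3 \<Rightarrow> real ^ 3" where
  "wall \<sigma> X Y = (\<sigma> / sqrt (lorentz (lcross X Y) (lcross X Y))) *\<^sub>R lcross X Y"

lemma lorentz_wall:
  "lorentz U (wall \<sigma> X Y) = \<sigma> * lorentz (lcross X Y) U / sqrt (lorentz (lcross X Y) (lcross X Y))"
  unfolding lorentz_commute[of U "wall \<sigma> X Y"] by (simp add: wall_def lorentz_linear)

lemma wall_orthogonal: "lorentz X (wall \<sigma> X Y) = 0" "lorentz Y (wall \<sigma> X Y) = 0"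
  by (simp_all add: lorentz_wall)

lemma wall_unit:
  assumes "X \<in> H2" "Y \<in> H2" "X \<noteq> Y" "\<sigma> * \<sigma> = 1"
  shows "lorentz (wall \<sigma> X Y) (wall \<sigma> X Y) = 1"
proof -
  let ?n = "lorentz (lcross X Y) (lcross X Y)"
  have n: "0 < ?n" by (rule lcross_norm_pos[OF assms(1-3)])
  have "lorentz (wall \<sigma> X Y) (wall \<sigma> X Y) = (\<sigma> * \<sigma>) * ?n / (sqrt ?n * sqrt ?n)"
    by (simp add: wall_def lorentz_linear)
  then show ?thesis using n assms(4) by simp
qed

text \<open>Tangent vectors have the same products as the cross products, up to a sign that comes
  from the cyclic order \<open>Y P\<close>, \<open>P X\<close>. Both walls carry the same
  \<open>\<sigma>\<close>, so it cancels.\<close>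

lemma wall_angle:
  assumes P: "P \<in> H2" and X: "X \<in> H2" "X \<noteq> P" and Y: "Y \<in> H2" "Y \<noteq> P" and \<sigma>: "\<sigma> * \<sigma> = 1"
  shows "lorentz (wall \<sigma> Y P) (wall \<sigma> P X) = - cos (hangle X P Y)"
proof -
  let ?u = "htangent P X" and ?v = "htangent P Y"
  have l: "lorentz P P = - 1" "lorentz X X = - 1" "lorentz Y Y = - 1"
    using P X Y by (auto simp: H2_def)
  have u: "lorentz P ?u = 0" and v: "lorentz P ?v = 0"
    by (simp_all add: htangent_def lorentz_linear l)
  have uu: "lorentz ?u ?u = lorentz (lcross P X) (lcross P X)"
    and vv: "lorentz ?v ?v = lorentz (lcross Y P) (lcross Y P)"
    and uv: "lorentz ?u ?v = - lorentz (lcross Y P) (lcross P X)"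
    unfolding lorentz_lcross_lcross
    by (simp_all add: htangent_def lorentz_linear l lorentz_commute[of X P] lorentz_commute[of Y P]
        lorentz_commute[of Y X])
  have pos: "0 < lorentz ?u ?u" "0 < lorentz ?v ?v"
    unfolding uu vv using lcross_norm_pos P X Y by metis+
  define q where "q = lorentz ?u ?v / (sqrt (lorentz ?u ?u) * sqrt (lorentz ?v ?v))"
  have "q\<^sup>2 \<le> 1"
    using lorentz_tangent_cauchy_schwarz[OF P u v] pos
    by (simp add: q_def power_divide power_mult_distrib)
  then have "\<bar>q\<bar> \<le> 1" by (simp add: abs_square_le_1)
  then have "cos (hangle X P Y) = q" by (simp add: hangle_def q_def[symmetric] cos_arccos_abs)
  moreover have "lorentz (wall \<sigma> Y P) (wall \<sigma> P X) = (\<sigma> * \<sigma>) * (- q)"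
    unfolding q_def uv unfolding uu vv by (simp add: wall_def lorentz_linear)
  ultimately show ?thesis using \<sigma> by simp
qed

text \<open>With the sides taken in cyclic order all triple products equal one determinant
  \<open>D\<close>, and choosing \<open>\<sigma>\<close> as its sign turns all three normals
  inward.\<close>

lemma htriangle_roots:
  assumes tri: "htriangle A B C" and angles: "hangle B A C = pi / real q" "hangle A B C = pi / real p\<^sub>1"
    "hangle A C B = pi / real p\<^sub>2" and ge: "2 \<le> q" "2 \<le> p\<^sub>1" "2 \<le> p\<^sub>2"
  defines "V \<equiv> \<lambda>i :: 3. if i = 1 then A else if i = 2 then B else C"
    and "m \<equiv> \<lambda>i j :: 3. if i \<noteq> 1 \<and> j \<noteq> 1 then q else if i \<noteq> 2 \<and> j \<noteq> 2 then p\<^sub>1 else p\<^sub>2"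
  obtains \<alpha> where "hyperbolic_triangle \<alpha> m V"
proof -
  define D where "D = lorentz (lcross A B) C"
  define \<sigma> where "\<sigma> = sgn D"
  define \<alpha> where "\<alpha> i = (if i = 1 then wall \<sigma> B C else if i = 2 then wall \<sigma> C A else wall \<sigma> A B)" for i :: 3
  have D: "D \<noteq> 0" using htriangle_det[OF tri] by (simp add: D_def)
  then have \<sigma>: "\<sigma> * \<sigma> = 1" "\<sigma> * D > 0" by (auto simp: \<sigma>_def sgn_real_def)
  have H: "A \<in> H2" "B \<in> H2" "C \<in> H2" using tri by (auto simp: htriangle_def)
  have "lcross X X = 0" for X by (simp add: lcross_def vec_eq_iff forall_3)
  then have ne: "A \<noteq> B" "B \<noteq> C" "C \<noteq> A"
    using D lorentz_lcross_rotate[of A B C] lorentz_lcross_rotate[of B C A]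
    by (auto simp: D_def lorentz_linear)
  have D': "lorentz (lcross B C) A = D" "lorentz (lcross C A) B = D"
    using lorentz_lcross_rotate[of A B C] lorentz_lcross_rotate[of B C A] by (simp_all add: D_def)
  have "hyperbolic_triangle \<alpha> m V"
  proof
    show "lorentz (\<alpha> i) (\<alpha> i) = 1" for i
      using wall_unit H ne \<sigma> by (simp add: \<alpha>_def)
    have "lorentz (\<alpha> 2) (\<alpha> 3) = - cos (pi / real q)" "lorentz (\<alpha> 3) (\<alpha> 1) = - cos (pi / real p\<^sub>1)"
      "lorentz (\<alpha> 1) (\<alpha> 2) = - cos (pi / real p\<^sub>2)"
      using wall_angle[of A B C \<sigma>] wall_angle[of B C A \<sigma>] wall_angle[of C A B \<sigma>] H ne \<sigma> angles
      by (simp_all add: \<alpha>_def hangle_commute[of C B A])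
    then show "lorentz (\<alpha> i) (\<alpha> j) = - cos (pi / real (m i j))" if "i \<noteq> j" for i j
      using exhaust_3[of i] exhaust_3[of j] that
      by (elim disjE) (simp_all add: m_def lorentz_commute[of "\<alpha> 3" "\<alpha> 2"] lorentz_commute[of "\<alpha> 1" "\<alpha> 3"]
          lorentz_commute[of "\<alpha> 2" "\<alpha> 1"])
    show "2 \<le> m i j" for i j using ge by (simp add: m_def)
    show "V i \<in> H2" for i using H by (simp add: V_def)
    show "lorentz (V i) (\<alpha> j) = 0" if "i \<noteq> j" for i j
      using exhaust_3[of i] exhaust_3[of j] that
      by (elim disjE) (simp_all add: V_def \<alpha>_def wall_orthogonal)
    have opp: "lorentz U (wall \<sigma> X Y) > 0" if "lorentz (lcross X Y) U = D" "X \<in> H2" "Y \<in> H2" "X \<noteq> Y" for U X Y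
      using \<sigma> lcross_norm_pos[OF that(2-4)] that(1)
      by (simp add: lorentz_wall)
    then show "0 < lorentz (V i) (\<alpha> i)" for i
      using H ne D' D_def by (simp add: V_def \<alpha>_def)
    have coeff: "lorentz X (wall \<sigma> Y Z) / lorentz U (wall \<sigma> Y Z) = lorentz (lcross Y Z) X / D"
      if "lorentz (lcross Y Z) U = D" "Y \<in> H2" "Z \<in> H2" "Y \<noteq> Z" for X Y Z U
      using \<sigma> lcross_norm_pos[OF that(2-4)] that(1)
      by (auto simp: lorentz_wall)
    show "X = (\<Sum>i\<in>UNIV. (lorentz X (\<alpha> i) / lorentz (V i) (\<alpha> i)) *\<^sub>R V i)" for X
    proof -
      have "D *\<^sub>R X = D *\<^sub>R (\<Sum>i\<in>UNIV. (lorentz X (\<alpha> i) / lorentz (V i) (\<alpha> i)) *\<^sub>R V i)"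
        using lcross_expand[of A B C X] D H ne D'
        by (simp add: sum_3 V_def \<alpha>_def coeff[OF D'(1)] coeff[OF D'(2)] coeff[OF D_def[symmetric]]
            scaleR_add_right flip: D_def)
      then show ?thesis by (rule scaleR_left_imp_eq[OF D])
    qed
  qed
  with that show ?thesis .
qed

lemma (in hyperbolic_triangle) interior_eq_chamber:
  "htriangle_interior (V 1) (V 2) (V 3) = chamber"
proof (intro equalityI subsetI)
  fix X assume "X \<in> htriangle_interior (V 1) (V 2) (V 3)"
  then obtain a b c where X: "X \<in> H2" "0 < a" "0 < b" "0 < c" "X = a *\<^sub>R V 1 + b *\<^sub>R V 2 + c *\<^sub>R V 3"
    by (auto simp: htriangle_interior_def)
  have "0 < lorentz X (\<alpha> i)" for i
    using exhaust_3[of i] X vertex_opposite[of i] by (auto simp: lorentz_linear vertex_orthogonal)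
  with X(1) show "X \<in> chamber" by (simp add: chamber_def)
next
  fix X assume X: "X \<in> chamber"
  then have "0 < lorentz X (\<alpha> i) / lorentz (V i) (\<alpha> i)" for i
    using chamberD(2) vertex_opposite by simp
  moreover have "X = (lorentz X (\<alpha> 1) / lorentz (V 1) (\<alpha> 1)) *\<^sub>R V 1 +
      (lorentz X (\<alpha> 2) / lorentz (V 2) (\<alpha> 2)) *\<^sub>R V 2 + (lorentz X (\<alpha> 3) / lorentz (V 3) (\<alpha> 3)) *\<^sub>R V 3"
    using vertex_expand[of X] by (simp add: sum_3)
  ultimately show "X \<in> htriangle_interior (V 1) (V 2) (V 3)"
    using chamberD(1)[OF X] unfolding htriangle_interior_def by blast
qed

section \<open>The orbit of the rotation group\<close>

lemma BijGroup_mult_apply: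
  "g \<in> carrier (BijGroup S) \<Longrightarrow> h \<in> carrier (BijGroup S) \<Longrightarrow> x \<in> S \<Longrightarrow> (g \<otimes>\<^bsub>BijGroup S\<^esub> h) x = g (h x)"
  by (simp add: BijGroup_def compose_eq)

lemma BijGroup_inv_apply:
  assumes "g \<in> carrier (BijGroup S)" "x \<in> S"
  shows "(inv\<^bsub>BijGroup S\<^esub> g) (g x) = x"
proof -
  interpret group "BijGroup S" by (rule group_BijGroup)
  have "(inv\<^bsub>BijGroup S\<^esub> g) (g x) = (inv\<^bsub>BijGroup S\<^esub> g \<otimes>\<^bsub>BijGroup S\<^esub> g) x"
    by (rule BijGroup_mult_apply[OF inv_closed[OF assms(1)] assms, symmetric])
  also have "\<dots> = \<one>\<^bsub>BijGroup S\<^esub> x" using assms(1) by simp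
  also have "\<dots> = x" using assms(2) by (simp add: BijGroup_def)
  finally show ?thesis .
qed

context hyperbolic_triangle
begin

text \<open>Agreement is asked only on \<open>H2\<close> because elements of
  \<open>BijGroup H2\<close> are extensional, whereas \<open>refls\<close> is defined on all
  vectors.\<close>

definition acts :: "(real ^ 3 \<Rightarrow> real ^ 3) \<Rightarrow> 3 list \<Rightarrow> bool" where
  "acts g w \<longleftrightarrow> (\<forall>X\<in>H2. g X = refls w X)"

lemma acts_mult:
  assumes "g \<in> carrier (BijGroup H2)" "h \<in> carrier (BijGroup H2)" "acts g u" "acts h v"
  shows "acts (g \<otimes>\<^bsub>BijGroup H2\<^esub> h) (u @ v)"
  unfolding acts_def
proof
  fix X assume "X \<in> H2"
  with assms refls_H2[of X v] show "(g \<otimes>\<^bsub>BijGroup H2\<^esub> h) X = refls (u @ v) X"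
    by (simp add: BijGroup_mult_apply acts_def)
qed

lemma acts_inv:
  assumes "g \<in> carrier (BijGroup H2)" "acts g w"
  shows "acts (inv\<^bsub>BijGroup H2\<^esub> g) (rev w)"
  unfolding acts_def
proof
  fix X assume X: "X \<in> H2"
  have "g (refls (rev w) X) = X"
    using assms(2) refls_H2[OF X] refls_rev[of "rev w" X] by (simp add: acts_def)
  with BijGroup_inv_apply[OF assms(1) refls_H2[OF X, of "rev w"]]
  show "(inv\<^bsub>BijGroup H2\<^esub> g) X = refls (rev w) X" by simp
qed

text \<open>One inclusion needs every group element to be an even word; for the other,
  \<open>cellI\<close> asks only that the products of two reflections lie in the group.\<close>

lemma dirichlet_cell_eq_cell:
  assumes carrier: "g\<^sub>0 \<in> carrier (BijGroup H2)" "g\<^sub>1 \<in> carrier (BijGroup H2)"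
    and g0: "acts g\<^sub>0 [2, 3] \<or> acts g\<^sub>0 [3, 2]" and g1: "acts g\<^sub>1 [1, 3] \<or> acts g\<^sub>1 [3, 1]"
    and K: "K \<in> chamber"
  shows "dirichlet_cell (generate (BijGroup H2) {g\<^sub>0, g\<^sub>1}) K = cell K"
proof -
  interpret G: group "BijGroup H2" by (rule group_BijGroup)
  let ?\<Gamma> = "generate (BijGroup H2) {g\<^sub>0, g\<^sub>1}"
  have KH: "K \<in> H2" by (rule chamberD(1)[OF K])
  have sub: "subgroup ?\<Gamma> (BijGroup H2)" using carrier by (intro G.generate_is_subgroup) simp
  note in_carrier = subgroup.mem_carrier[OF sub]
  have even_word: "\<exists>w. even (length w) \<and> acts g w" if "g \<in> ?\<Gamma>" for g
    using that
  proof (induction rule: generate.induct)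
    case one
    have "acts \<one>\<^bsub>BijGroup H2\<^esub> []" by (simp add: acts_def BijGroup_def)
    then show ?case by (intro exI[of _ "[]"]) simp
  next
    case (incl h)
    then obtain i j where "acts h [i, j]" using g0 g1 by auto
    then show ?case by (intro exI[of _ "[i, j]"]) simp
  next
    case (inv h)
    then obtain i j where "acts h [i, j]" using g0 g1 by auto
    moreover have "h \<in> carrier (BijGroup H2)" using inv carrier by auto
    ultimately show ?case using acts_inv[of h "[i, j]"] by (intro exI[of _ "rev [i, j]"]) simp
  next
    case (eng h1 h2)
    then obtain u v where "even (length u)" "acts h1 u" "even (length v)" "acts h2 v" by blast
    with acts_mult[OF in_carrier in_carrier, OF eng.hyps] show ?case
      by (intro exI[of _ "u @ v"]) simp
  qed
  \<comment> \<open>\<open>R\<close> is symmetric through inverses and transitive since the middle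
    letter cancels, so the two generators, in either sense, yield all pairs.\<close>
  define R where "R i j \<longleftrightarrow> (\<exists>g\<in>?\<Gamma>. acts g [i, j])" for i j
  have R_sym: "R j i" if "R i j" for i j
    using that acts_inv[OF in_carrier, of _ "[i, j]"] subgroup.m_inv_closed[OF sub]
    unfolding R_def by force
  have R_trans: "R i k" if ij: "R i j" and jk: "R j k" for i j k
  proof -
    obtain g h where gh: "g \<in> ?\<Gamma>" "acts g [i, j]" "h \<in> ?\<Gamma>" "acts h [j, k]"
      using ij jk by (auto simp: R_def)
    have "acts (g \<otimes>\<^bsub>BijGroup H2\<^esub> h) ([i, j] @ [j, k])"
      using acts_mult[OF in_carrier in_carrier] gh by blast
    then have "acts (g \<otimes>\<^bsub>BijGroup H2\<^esub> h) [i, k]" by (simp add: acts_def hrefl_hrefl)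
    then show ?thesis using subgroup.m_closed[OF sub] gh unfolding R_def by blast
  qed
  have "g\<^sub>0 \<in> ?\<Gamma>" "g\<^sub>1 \<in> ?\<Gamma>" by (simp_all add: generate.incl)
  then have "R 2 3" "R 1 3" using g0 g1 R_sym unfolding R_def by blast+
  then have R: "R i j" if "i \<noteq> j" for i j
    using exhaust_3[of i] exhaust_3[of j] that R_sym R_trans by metis
  show ?thesis
  proof (intro equalityI subsetI)
    fix X assume "X \<in> dirichlet_cell ?\<Gamma> K"
    then have X: "X \<in> H2" and le: "\<And>g. g \<in> ?\<Gamma> \<Longrightarrow> hdist K X \<le> hdist (g K) X"
      by (auto simp: dirichlet_cell_def)
    show "X \<in> cell K"
    proof (rule cellI[OF K X])
      fix i j :: 3 assume "i \<noteq> j"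
      then obtain g where g: "g \<in> ?\<Gamma>" "g K = refls [i, j] K"
        using R KH unfolding R_def acts_def by blast
      from le[OF g(1)] show "lorentz X (refls [i, j] K) \<le> lorentz X K"
        unfolding g(2) hdist_le_iff[OF KH X refls_H2[OF KH] X] lorentz_commute[of _ X] .
    qed
  next
    fix X assume "X \<in> cell K"
    then have X: "X \<in> H2" and le: "\<And>w. even (length w) \<Longrightarrow> lorentz X (refls w K) \<le> lorentz X K"
      by (auto simp: cell_def)
    have "hdist K X \<le> hdist (g K) X" if "g \<in> ?\<Gamma>" for g
    proof -
      obtain w where w: "even (length w)" "g K = refls w K"
        using even_word[OF \<open>g \<in> ?\<Gamma>\<close>] KH by (auto simp: acts_def)
      show ?thesis
        unfolding w(2) hdist_le_iff[OF KH X refls_H2[OF KH] X] lorentz_commute[of _ X] using w(1) by (rule le)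
    qed
    with X show "X \<in> dirichlet_cell ?\<Gamma> K" by (simp add: dirichlet_cell_def)
  qed
qed

end

theorem theorem4p1:
  fixes p\<^sub>1 p\<^sub>2 :: nat and A B C :: "real ^ 3" and g\<^sub>0 g\<^sub>1 g\<^sub>2 :: "real ^ 3 \<Rightarrow> real ^ 3"
    and \<Gamma>\<^sub>0 :: "(real ^ 3 \<Rightarrow> real ^ 3) set"
  assumes "p\<^sub>1 \<ge> 3" and "p\<^sub>2 \<ge> 3"
    and "pi / 2 + pi / real p\<^sub>1 + pi / real p\<^sub>2 < pi"
    and "htriangle A B C"
    and "hangle B A C = pi / 2"
    and "hangle A B C = pi / real p\<^sub>1"
    and "hangle A C B = pi / real p\<^sub>2"
    and "is_hrotation A pi g\<^sub>0"
    and "is_hrotation B (2 * pi / real p\<^sub>1) g\<^sub>1"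
    and "g\<^sub>2 = compose H2 g\<^sub>1 g\<^sub>0"
    and "is_hrotation C (2 * pi / real p\<^sub>2) g\<^sub>2"
    and "\<Gamma>\<^sub>0 = generate (BijGroup H2) {g\<^sub>0, g\<^sub>1}"
  shows "\<exists>!K. K \<in> htriangle_interior A B C \<and>
           circumscribed_about_circle_at (dirichlet_cell \<Gamma>\<^sub>0 K) K"
proof -
  define V where "V i = (if i = 1 then A else if i = 2 then B else C)" for i :: 3
  \<comment> \<open>For distinct \<open>i\<close>, \<open>j\<close> the order at the vertex where
    walls \<open>i\<close> and \<open>j\<close> meet, walls being numbered by the opposite
    vertex.\<close>
  define m where "m i j = (if i \<noteq> 1 \<and> j \<noteq> 1 then 2 else if i \<noteq> 2 \<and> j \<noteq> 2 then p\<^sub>1 else p\<^sub>2)" for i j :: 3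
  obtain \<alpha> where "hyperbolic_triangle \<alpha> m V"
    using htriangle_roots[OF assms(4), of 2 p\<^sub>1 p\<^sub>2] assms(1,2,5,6,7) unfolding V_def m_def by auto
  then interpret hyperbolic_triangle \<alpha> m V .
  have V: "V 1 = A" "V 2 = B" "V 3 = C" by (simp_all add: V_def)
  have carrier: "g\<^sub>0 \<in> carrier (BijGroup H2)" "g\<^sub>1 \<in> carrier (BijGroup H2)"
    using assms(8,9) by (auto simp: is_hrotation_def)
  have "lorentz (\<alpha> 2) (\<alpha> 3) = - cos (pi / 2)" "lorentz (\<alpha> 1) (\<alpha> 3) = - cos (2 * pi / real p\<^sub>1 / 2)"
    using root_angle[of 2 3] root_angle[of 1 3] by (simp_all add: m_def)
  moreover have "lorentz A (\<alpha> 2) = 0" "lorentz A (\<alpha> 3) = 0" "lorentz B (\<alpha> 1) = 0" "lorentz B (\<alpha> 3) = 0"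
    using vertex_orthogonal[of 1 2] vertex_orthogonal[of 1 3] vertex_orthogonal[of 2 1]
      vertex_orthogonal[of 2 3] by (simp_all add: V)
  ultimately have "acts g\<^sub>0 [2, 3] \<or> acts g\<^sub>0 [3, 2]" "acts g\<^sub>1 [1, 3] \<or> acts g\<^sub>1 [3, 1]"
    using rotation_eq_reflections[OF assms(8), of "\<alpha> 2" "\<alpha> 3"]
      rotation_eq_reflections[OF assms(9), of "\<alpha> 1" "\<alpha> 3"] by (simp_all add: acts_def)
  note dirichlet = dirichlet_cell_eq_cell[OF carrier this]
  have "K \<in> htriangle_interior A B C \<and> circumscribed_about_circle_at (dirichlet_cell \<Gamma>\<^sub>0 K) K \<longleftrightarrow>
      K \<in> chamber \<and> circumscribed_about_circle_at (cell K) K" for K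
    using dirichlet[of K] interior_eq_chamber by (auto simp: V assms(12))
  then show ?thesis using unique_circumscribed_cell by (simp add: m_def)
qed

end
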